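(* Let $\Omega \subset \mathbb{R}^n$ be a domain and let $\lambda > 0$ be such that for all $0 < \lambda' \leq \lambda$ one has $\mathrm{bmo}_{\lambda'}(\Omega) = \mathrm{bmo}_{\lambda}(\Omega)$ as sets. Then $$\Big\{f \in \mathrm{bmo}_\lambda(\Omega): \lim_{t \to 0^+} \omega_\Omega(f, t) = 0\Big\}= \overline{\mathrm{UC}(\Omega) \cap L^\infty(\Omega)} = \overline{\mathrm{Lip}_b(\Omega)} = \overline{\mathrm{Lip}_{b,0}(\Omega)},$$ where the closures are taken in $\mathrm{bmo}_\lambda(\Omega)$ with respect to $\|\cdot\|_{\mathrm{bmo}_\lambda(\Omega)}$.
   Context: A domain is a connected open set. All cubes $Q$ have sides parallel to the axes; $\ell(Q)$ is the sidelength and $f_Q = \frac{1}{|Q|}\int_Q f$, so $|f|_Q$ is the average of $|f|$ on $Q$. The modulus of mean oscillation on $\Omega$ is $$\omega_\Omega(f,t) := \sup_{Q \subset \Omega,\ \ell(Q)<t} \frac{1}{|Q|}\int_Q |f(x)-f_Q|\,dx, \quad t>0.$$ For $\lambda>0$, $\mathrm{bmo}_\lambda(\Omega)$ is the set of functions $f$ on $\Omega$ that are integrable on every cube $Q\subset\Omega$ and satisfy $$\|f\|_{\mathrm{bmo}_\lambda(\Omega)} := \omega_\Omega(f,\lambda) + \sup_{Q\subset\Omega,\ \ell(Q)\ge\lambda} |f|_Q < \infty.$$ (One has $\|f\|_{\mathrm{bmo}_\lambda(\Omega)} \lesssim \|f\|_\infty$, so bounded measurable functions belong to $\mathrm{bmo}_\lambda(\Omega)$.)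 $\mathrm{UC}(\Omega)$ denotes the uniformly continuous functions on $\Omega$. $\mathrm{Lip}_b(\Omega)$ denotes the bounded Lipschitz functions on $\Omega$ (Lipschitz with respect to the Euclidean distance), equipped with the norm $\|f\|_{\mathrm{Lip}_b} := \|f\|_\infty + \sup_{x\ne y}\frac{|f(x)-f(y)|}{|x-y|}$. $\mathrm{Lip}_{b,0}(\Omega)$ consists of those $f\in \mathrm{Lip}_b(\Omega)$ with $\mathrm{dist}(\mathrm{supp}(f),\partial\Omega)>0$. Conventions: the distance to or from the empty set is $+\infty$, and a supremum over an empty family of cubes is $0$. *)

theory Defs
  imports "HOL-Analysis.Analysis"
begin

text \<open>
  A function on \<open>\<Omega>\<close> is represented by a total function of which only the values on \<open>\<Omega>\<close> matter:
  every notion below depends on the restriction of \<open>f\<close> to \<open>\<Omega>\<close> only.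
  Cubes are closed and have positive sidelength.
\<close>

definition cube :: "real ^ 'n \<Rightarrow> real \<Rightarrow> (real ^ 'n) set" where
  "cube a l = cbox a (\<chi> i. a $ i + l)"

definition average :: "(real ^ 'n) set \<Rightarrow> (real ^ 'n \<Rightarrow> real) \<Rightarrow> real" where
  "average Q f = (LINT x:Q|lebesgue. f x) / measure lebesgue Q"

text \<open>
  Suprema are taken in \<^typ>\<open>ennreal\<close>, so that they may be infinite and the supremum of the empty
  family is \<open>0\<close>. Averages are Bochner integrals (\<open>0\<close> for a non-integrable function), so the two
  suprema below are meaningful only for functions that are integrable on every cube in \<open>\<Omega>\<close>; this
  is part of the definition of \<open>bmo\<close>.
\<close>

definition osc_modulus :: "(real ^ 'n) set \<Rightarrow> (real ^ 'n \<Rightarrow> real) \<Rightarrow> real \<Rightarrow> ennreal" where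
  "osc_modulus \<Omega> f t =
     (SUP (a, l) \<in> {(a, l). 0 < l \<and> l < t \<and> cube a l \<subseteq> \<Omega>}.
        ennreal (average (cube a l) (\<lambda>x. \<bar>f x - average (cube a l) f\<bar>)))"

definition bmo_norm :: "real \<Rightarrow> (real ^ 'n) set \<Rightarrow> (real ^ 'n \<Rightarrow> real) \<Rightarrow> ennreal" where
  "bmo_norm lam \<Omega> f =
     osc_modulus \<Omega> f lam +
     (SUP (a, l) \<in> {(a, l). 0 < l \<and> lam \<le> l \<and> cube a l \<subseteq> \<Omega>}.
        ennreal (average (cube a l) (\<lambda>x. \<bar>f x\<bar>)))"

definition bmo :: "real \<Rightarrow> (real ^ 'n) set \<Rightarrow> (real ^ 'n \<Rightarrow> real) set" where
  "bmo lam \<Omega> =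
     {f. (\<forall>a l. 0 < l \<and> cube a l \<subseteq> \<Omega> \<longrightarrow> f absolutely_integrable_on cube a l) \<and>
         bmo_norm lam \<Omega> f < \<infinity>}"

text \<open>
  \<^const>\<open>bmo_norm\<close> is in general only a seminorm (it ignores null sets, and also constants when
  \<open>\<Omega>\<close> contains no cube of sidelength at least \<open>lam\<close>), so the closure is written out.
\<close>

definition bmo_closure ::
    "real \<Rightarrow> (real ^ 'n) set \<Rightarrow> (real ^ 'n \<Rightarrow> real) set \<Rightarrow> (real ^ 'n \<Rightarrow> real) set" where
  "bmo_closure lam \<Omega> A =
     {f \<in> bmo lam \<Omega>. \<forall>e>0. \<exists>g \<in> A \<inter> bmo lam \<Omega>. bmo_norm lam \<Omega> (\<lambda>x. f x - g x) < ennreal e}"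

definition UC :: "(real ^ 'n) set \<Rightarrow> (real ^ 'n \<Rightarrow> real) set" where
  "UC \<Omega> = {f. uniformly_continuous_on \<Omega> f}"

definition Linfty :: "(real ^ 'n) set \<Rightarrow> (real ^ 'n \<Rightarrow> real) set" where
  "Linfty \<Omega> =
     {f. set_borel_measurable lebesgue \<Omega> f \<and> (\<exists>C. AE x\<in>\<Omega> in lebesgue. \<bar>f x\<bar> \<le> C)}"

definition Lip_b :: "(real ^ 'n) set \<Rightarrow> (real ^ 'n \<Rightarrow> real) set" where
  "Lip_b \<Omega> = {f. bounded (f ` \<Omega>) \<and> (\<exists>L. L-lipschitz_on \<Omega> f)}"

definition supp_on :: "(real ^ 'n) set \<Rightarrow> (real ^ 'n \<Rightarrow> real) \<Rightarrow> (real ^ 'n) set" where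
  "supp_on \<Omega> f = \<Omega> \<inter> closure {x \<in> \<Omega>. f x \<noteq> 0}"

text \<open>
  The library's \<^const>\<open>setdist\<close> is \<open>0\<close> when one of the sets is empty; here that distance must be
  infinite (\<open>\<Omega>\<close> may be the whole space, and \<open>f\<close> may be zero).
\<close>

definition set_edist :: "(real ^ 'n) set \<Rightarrow> (real ^ 'n) set \<Rightarrow> ennreal" where
  "set_edist A B = (INF x\<in>A. INF y\<in>B. ennreal (dist x y))"

definition Lip_b0 :: "(real ^ 'n) set \<Rightarrow> (real ^ 'n \<Rightarrow> real) set" where
  "Lip_b0 \<Omega> = {f \<in> Lip_b \<Omega>. set_edist (supp_on \<Omega> f) (frontier \<Omega>) > 0}"

end

theory Submission
  imports Defs
begin

text \<open>
  The inclusions \<open>closure Lip_b0 \<subseteq> closure Lip_b \<subseteq> closure (UC \<inter> Linfty) \<subseteq> vanishing oscillation\<close> are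
  soft. Conversely, let \<open>f\<close> have vanishing mean oscillation, small on cubes of side below \<open>s\<close>. The
  hypothesis on \<open>bmo\<close> bounds the averages of \<open>\<bar>f\<bar>\<close> over all cubes of side at least \<open>s\<close>, and
  truncating \<open>f\<close> above that bound changes it little in norm. A bounded \<open>f\<close> is approximated by
  \<open>\<phi> * u\<close>, where \<open>u\<close> averages \<open>f\<close> at a fixed scale and \<open>\<phi>\<close> is a Lipschitz cut-off vanishing near
  the complement of \<open>\<Omega>\<close>. Cubes in \<open>\<Omega>\<close> see \<open>log dist(x, - \<Omega>)\<close> as a function of bounded mean
  oscillation, so \<open>\<phi>\<close>, which behaves like a small multiple of that logarithm, can be given
  arbitrarily small mean oscillation.
\<close>

text \<open>The norm at \<open>lam\<close> bounds averages only over cubes of side at least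
  \<open>lam\<close>. On a planar strip of width below \<open>lam\<close>, a linear function growing
  along the strip has finite norm although its averages over cubes of a fixed smaller side are
  unbounded. The hypothesis on \<open>bmo\<close> excludes this, and a bound on averages is what
  makes truncation possible. Boundedness in turn is forced by the cut-off: multiplying by
  \<open>\<phi>\<close> costs the bound \<open>M\<close> times the oscillation of
  \<open>\<phi>\<close>, so that oscillation must be of order \<open>e / M\<close>, whereas a
  Lipschitz cut-off at a single scale \<open>t\<close> can have oscillation of order one on cubes of
  side about \<open>t\<close>. Hence the parameters are chosen in the order \<open>s\<close>,
  \<open>M\<close>, \<open>\<eta>\<close>, and last the averaging scale \<open>r\<close>, small
  against \<open>\<eta>\<close>.\<close>

definition osc :: "(real ^ 'n) set \<Rightarrow> (real ^ 'n \<Rightarrow> real) \<Rightarrow> real" where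
  "osc Q f = average Q (\<lambda>x. \<bar>f x - average Q f\<bar>)"

subsection \<open>Averages over sets of finite measure\<close>

lemma average_mono:
  assumes "f absolutely_integrable_on Q" "g absolutely_integrable_on Q"
    and "\<And>x. x \<in> Q \<Longrightarrow> f x \<le> g x"
  shows "average Q f \<le> average Q g"
  unfolding average_def using assms by (intro divide_right_mono set_integral_mono) auto

lemma average_add:
  assumes "f absolutely_integrable_on Q" "g absolutely_integrable_on Q"
  shows "average Q (\<lambda>x. f x + g x) = average Q f + average Q g"
  unfolding average_def using assms by (simp add: add_divide_distrib)

lemma average_diff:
  assumes "f absolutely_integrable_on Q" "g absolutely_integrable_on Q"
  shows "average Q (\<lambda>x. f x - g x) = average Q f - average Q g"
  unfolding average_def using assms by (simp add: diff_divide_distrib)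

lemma average_cmult: "average Q (\<lambda>x. c * f x) = c * average Q f"
  unfolding average_def by simp

lemma average_cong: "(\<And>x. x \<in> Q \<Longrightarrow> f x = g x) \<Longrightarrow> average Q f = average Q g"
  unfolding average_def set_lebesgue_integral_def
  by (intro arg_cong2[where f = "(/)"] Bochner_Integration.integral_cong) (auto simp: indicator_def)

lemma average_const:
  assumes "Q \<in> lmeasurable" "measure lebesgue Q > 0"
  shows "average Q (\<lambda>x. c) = c"
  using assms unfolding average_def
  by (simp add: set_lebesgue_integral_def fmeasurable_def)

lemma average_nonneg:
  assumes "\<And>x. x \<in> Q \<Longrightarrow> 0 \<le> f x"
  shows "0 \<le> average Q f"
  unfolding average_def set_lebesgue_integral_def
  by (intro divide_nonneg_nonneg Bochner_Integration.integral_nonneg)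
     (auto simp: indicator_def assms)

lemma abs_average_le:
  assumes "f absolutely_integrable_on Q"
  shows "\<bar>average Q f\<bar> \<le> average Q (\<lambda>x. \<bar>f x\<bar>)"
proof -
  have "average Q f \<le> average Q (\<lambda>x. \<bar>f x\<bar>)"
    by (intro average_mono assms set_integrable_abs) auto
  moreover have "average Q (\<lambda>x. (-1) * f x) \<le> average Q (\<lambda>x. \<bar>f x\<bar>)"
    by (intro average_mono assms set_integrable_abs set_integrable_mult_right) auto
  ultimately show ?thesis by (simp only: average_cmult)
qed

lemma average_sum:
  assumes "\<And>i. i \<in> I \<Longrightarrow> f i absolutely_integrable_on Q"
  shows "average Q (\<lambda>x. \<Sum>i\<in>I. f i x) = (\<Sum>i\<in>I. average Q (f i))"
  using assms unfolding average_def set_lebesgue_integral_def set_integrable_def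
  by (simp add: scaleR_sum_right sum_divide_distrib Bochner_Integration.integral_sum
      flip: real_scaleR_def)

lemma average_le_const:
  assumes "Q \<in> lmeasurable" "measure lebesgue Q > 0" "f absolutely_integrable_on Q"
    and "\<And>x. x \<in> Q \<Longrightarrow> f x \<le> c"
  shows "average Q f \<le> c"
  using average_mono[of Q f "\<lambda>x. c"] assms average_const[of Q c] absolutely_integrable_on_const
  by metis

lemma abs_average_le_const:
  assumes "Q \<in> lmeasurable" "measure lebesgue Q > 0" "f absolutely_integrable_on Q"
    and "\<And>x. x \<in> Q \<Longrightarrow> \<bar>f x\<bar> \<le> c"
  shows "\<bar>average Q f\<bar> \<le> c"
  using abs_average_le[of Q f] average_le_const[of Q "\<lambda>x. \<bar>f x\<bar>" c] assms
  by (force intro: set_integrable_abs order_trans)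

lemma abs_average_minus_le:
  assumes "Q \<in> lmeasurable" "measure lebesgue Q > 0" "f absolutely_integrable_on Q"
  shows "\<bar>average Q f - c\<bar> \<le> average Q (\<lambda>x. \<bar>f x - c\<bar>)"
proof -
  have "average Q f - c = average Q (\<lambda>x. f x - c)"
    using assms by (simp add: average_diff average_const absolutely_integrable_on_const)
  then show ?thesis
    using abs_average_le[of Q "\<lambda>x. f x - c"] assms by (simp add: absolutely_integrable_on_const)
qed

text \<open>Enlarging the set only increases the integral of a nonnegative function. Applied to
  \<open>\<bar>f - c\<bar>\<close> on cubes of comparable side, the ratio of measures is the source
  of the factors \<open>4 ^ CARD('n)\<close> below.\<close>

lemma average_subset_le:
  assumes "P \<subseteq> Q" "P \<in> lmeasurable" "Q \<in> lmeasurable" "measure lebesgue P > 0"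
    and "h absolutely_integrable_on Q" "\<And>x. x \<in> Q \<Longrightarrow> 0 \<le> h x"
  shows "average P h \<le> measure lebesgue Q / measure lebesgue P * average Q h"
proof -
  have Q: "measure lebesgue Q > 0"
    using assms measure_mono_fmeasurable[of P Q lebesgue] by (auto simp: fmeasurableD)
  have "h absolutely_integrable_on P"
    using assms by (intro set_integrable_subset[of lebesgue Q h P]) auto
  then have "(LINT x:P|lebesgue. h x) \<le> (LINT x:Q|lebesgue. h x)"
    unfolding set_lebesgue_integral_def using assms
    by (intro integral_mono) (auto simp: set_integrable_def indicator_def)
  then show ?thesis
    using Q assms(4) unfolding average_def by (simp add: field_simps)
qed

subsection \<open>Mean oscillation\<close>

lemma osc_nonneg: "0 \<le> osc Q f"
  unfolding osc_def by (rule average_nonneg) simp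

lemma absolutely_integrable_on_abs_minus_const:
  fixes f :: "real ^ 'n \<Rightarrow> real"
  assumes "Q \<in> lmeasurable" "f absolutely_integrable_on Q"
  shows "(\<lambda>x. \<bar>f x - c\<bar>) absolutely_integrable_on Q"
  using assms by (intro set_integrable_abs set_integral_diff absolutely_integrable_on_const)

text \<open>By the triangle inequality the mean is, up to a factor 2, as good as any other constant.
  Oscillations are therefore estimated against whatever constant is convenient.\<close>

lemma osc_le:
  assumes Q: "Q \<in> lmeasurable" "measure lebesgue Q > 0" and f: "f absolutely_integrable_on Q"
  shows "osc Q f \<le> 2 * average Q (\<lambda>x. \<bar>f x - c\<bar>)"
proof -
  have "osc Q f \<le> average Q (\<lambda>x. \<bar>f x - c\<bar> + \<bar>average Q f - c\<bar>)"
    unfolding osc_def using Q f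
    by (intro average_mono set_integral_add absolutely_integrable_on_abs_minus_const
        absolutely_integrable_on_const) auto
  also have "\<dots> = average Q (\<lambda>x. \<bar>f x - c\<bar>) + \<bar>average Q f - c\<bar>"
    using Q f by (simp add: average_add average_const absolutely_integrable_on_const
        absolutely_integrable_on_abs_minus_const)
  finally show ?thesis using abs_average_minus_le[OF Q f, of c] by simp
qed

lemma osc_le_average_abs:
  assumes "Q \<in> lmeasurable" "measure lebesgue Q > 0" "f absolutely_integrable_on Q"
  shows "osc Q f \<le> 2 * average Q (\<lambda>x. \<bar>f x\<bar>)"
  using osc_le[OF assms, of 0] by simp

lemma osc_le_const:
  assumes "Q \<in> lmeasurable" "measure lebesgue Q > 0" "f absolutely_integrable_on Q"
    and "\<And>x. x \<in> Q \<Longrightarrow> \<bar>f x - c\<bar> \<le> e"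
  shows "osc Q f \<le> 2 * e"
  using osc_le[OF assms(1-3), of c]
    average_le_const[OF assms(1,2) absolutely_integrable_on_abs_minus_const[OF assms(1,3)], of c e]
    assms(4) by force

lemma osc_add:
  assumes Q: "Q \<in> lmeasurable" and f: "f absolutely_integrable_on Q"
    and g: "g absolutely_integrable_on Q"
  shows "osc Q (\<lambda>x. f x + g x) \<le> osc Q f + osc Q g"
proof -
  have "osc Q (\<lambda>x. f x + g x) \<le> average Q (\<lambda>x. \<bar>f x - average Q f\<bar> + \<bar>g x - average Q g\<bar>)"
    unfolding osc_def average_add[OF f g] using Q f g
    by (intro average_mono set_integral_add absolutely_integrable_on_abs_minus_const) auto
  also have "\<dots> = osc Q f + osc Q g"
    unfolding osc_def using Q f g
    by (intro average_add absolutely_integrable_on_abs_minus_const)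
  finally show ?thesis .
qed

lemma osc_cmult: "osc Q (\<lambda>x. c * f x) = \<bar>c\<bar> * osc Q f"
  unfolding osc_def average_cmult right_diff_distrib[symmetric] abs_mult ..

lemma osc_diff:
  assumes "Q \<in> lmeasurable" "f absolutely_integrable_on Q" "g absolutely_integrable_on Q"
  shows "osc Q (\<lambda>x. f x - g x) \<le> osc Q f + osc Q g"
proof -
  have "osc Q (\<lambda>x. f x + (-1) * g x) \<le> osc Q f + osc Q (\<lambda>x. (-1) * g x)"
    using assms by (intro osc_add set_integrable_mult_right)
  then show ?thesis unfolding osc_cmult by simp
qed

lemma osc_const_diff:
  assumes "Q \<in> lmeasurable" "measure lebesgue Q > 0" "f absolutely_integrable_on Q"
  shows "osc Q (\<lambda>x. c - f x) = osc Q f"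
proof -
  have "average Q (\<lambda>x. c - f x) = c - average Q f"
    using assms by (simp add: average_diff average_const absolutely_integrable_on_const)
  then show ?thesis by (simp add: osc_def abs_minus_commute)
qed

lemma osc_sum:
  assumes Q: "Q \<in> lmeasurable" "measure lebesgue Q > 0" and "finite I"
    and f: "\<And>i. i \<in> I \<Longrightarrow> f i absolutely_integrable_on Q"
  shows "osc Q (\<lambda>x. \<Sum>i\<in>I. f i x) \<le> (\<Sum>i\<in>I. osc Q (f i))"
  using \<open>finite I\<close> f
proof (induction I rule: finite_induct)
  case empty
  show ?case using average_const[OF Q, of 0] by (simp add: osc_def)
next
  case (insert i I)
  then have "osc Q (\<lambda>x. f i x + (\<Sum>j\<in>I. f j x)) \<le> osc Q (f i) + osc Q (\<lambda>x. \<Sum>j\<in>I. f j x)"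
    by (intro osc_add Q absolutely_integrable_sum) auto
  then show ?case using insert by fastforce
qed

text \<open>The comparison constant is \<open>g (average Q f)\<close>, which need not be the mean of
  the composition; this is where the factor 2 comes from.\<close>

lemma osc_lipschitz_comp:
  assumes Q: "Q \<in> lmeasurable" "measure lebesgue Q > 0"
    and f: "f absolutely_integrable_on Q" and g: "(\<lambda>x. g (f x)) absolutely_integrable_on Q"
    and lip: "\<And>s t. \<bar>g s - g t\<bar> \<le> \<bar>s - t\<bar>"
  shows "osc Q (\<lambda>x. g (f x)) \<le> 2 * osc Q f"
proof -
  have "average Q (\<lambda>x. \<bar>g (f x) - g (average Q f)\<bar>) \<le> osc Q f"
    unfolding osc_def using Q f g lip
    by (intro average_mono absolutely_integrable_on_abs_minus_const)
  then show ?thesis using osc_le[OF Q g, of "g (average Q f)"] by simp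
qed

text \<open>A Leibniz rule: the product is compared with the product of the two means, and passing
  to its own mean costs the factor 2.\<close>

lemma osc_mult:
  assumes Q: "Q \<in> lmeasurable" "measure lebesgue Q > 0"
    and f: "f absolutely_integrable_on Q" and g: "g absolutely_integrable_on Q"
    and fg: "(\<lambda>x. f x * g x) absolutely_integrable_on Q"
    and A: "\<And>x. x \<in> Q \<Longrightarrow> \<bar>f x\<bar> \<le> A" and B: "\<And>x. x \<in> Q \<Longrightarrow> \<bar>g x\<bar> \<le> B"
  shows "osc Q (\<lambda>x. f x * g x) \<le> 2 * (B * osc Q f + A * osc Q g)"
proof -
  let ?a = "average Q f" and ?b = "average Q g"
  have a: "\<bar>?a\<bar> \<le> A" using abs_average_le_const[OF Q f A] by simp
  have pt: "\<bar>f x * g x - ?a * ?b\<bar> \<le> B * \<bar>f x - ?a\<bar> + A * \<bar>g x - ?b\<bar>" if "x \<in> Q" for x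
  proof -
    have "\<bar>f x * g x - ?a * ?b\<bar> = \<bar>g x * (f x - ?a) + ?a * (g x - ?b)\<bar>"
      by (simp add: algebra_simps)
    also have "\<dots> \<le> \<bar>g x\<bar> * \<bar>f x - ?a\<bar> + \<bar>?a\<bar> * \<bar>g x - ?b\<bar>"
      by (metis abs_mult abs_triangle_ineq)
    also have "\<dots> \<le> B * \<bar>f x - ?a\<bar> + A * \<bar>g x - ?b\<bar>"
      using B[OF that] a by (intro add_mono mult_right_mono) auto
    finally show ?thesis .
  qed
  have i: "(\<lambda>x. B * \<bar>f x - ?a\<bar>) absolutely_integrable_on Q"
    "(\<lambda>x. A * \<bar>g x - ?b\<bar>) absolutely_integrable_on Q"
    using Q f g by (intro set_integrable_mult_right absolutely_integrable_on_abs_minus_const; simp)+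
  have "average Q (\<lambda>x. \<bar>f x * g x - ?a * ?b\<bar>)
      \<le> average Q (\<lambda>x. B * \<bar>f x - ?a\<bar> + A * \<bar>g x - ?b\<bar>)"
    using Q fg i pt by (intro average_mono set_integral_add absolutely_integrable_on_abs_minus_const)
  also have "\<dots> = B * osc Q f + A * osc Q g"
    using i by (simp add: average_add average_cmult osc_def)
  finally show ?thesis using osc_le[OF Q fg, of "?a * ?b"] by simp
qed

subsection \<open>Cubes\<close>

lemma mem_cube: "x \<in> cube a l \<longleftrightarrow> (\<forall>i. a $ i \<le> x $ i \<and> x $ i \<le> a $ i + l)"
  by (simp add: cube_def mem_box_cart)

lemma cube_mono: "l \<le> k \<Longrightarrow> cube a l \<subseteq> cube a k"
  by (force simp: subset_eq mem_cube intro: order_trans[OF _ add_left_mono])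

lemma cube_lmeasurable [simp]: "cube a l \<in> lmeasurable"
  by (simp add: cube_def)

lemma cube_sets_lebesgue [simp]: "cube a l \<in> sets lebesgue"
  by (simp add: fmeasurableD)

lemma measure_cube:
  fixes a :: "real ^ 'n"
  assumes "0 \<le> l"
  shows "measure lebesgue (cube a l) = l ^ CARD('n)"
proof -
  have "cube a l \<noteq> {}"
    using assms mem_cube[of a a l] by auto
  then show ?thesis
    using content_cbox_cart[of a "\<chi> i. a $ i + l"] by (simp add: cube_def)
qed

lemma measure_cube_pos:
  fixes a :: "real ^ 'n"
  shows "0 < l \<Longrightarrow> measure lebesgue (cube a l) > 0"
  by (simp add: measure_cube)

lemma compact_cube: "compact (cube a l)"
  by (simp add: cube_def)

lemma dist_le_sum_abs: "dist x y \<le> (\<Sum>i\<in>UNIV. \<bar>x $ i - y $ i\<bar>)"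
  for x y :: "real ^ 'n"
  unfolding dist_norm using norm_le_l1_cart[of "x - y"] by simp

lemma sum_abs_le_dist: "(\<Sum>i\<in>UNIV. \<bar>x $ i - y $ i\<bar>) \<le> real CARD('n) * dist x y"
  for x y :: "real ^ 'n"
proof -
  have "(\<Sum>i\<in>UNIV. \<bar>x $ i - y $ i\<bar>) \<le> (\<Sum>i\<in>(UNIV :: 'n set). dist x y)"
    unfolding dist_norm
    by (intro sum_mono) (metis component_le_norm_cart vector_minus_component)
  then show ?thesis by simp
qed

lemma dist_cube_le:
  fixes a :: "real ^ 'n"
  assumes "x \<in> cube a l" "y \<in> cube a l"
  shows "dist x y \<le> real CARD('n) * l"
proof -
  have "\<bar>x $ i - y $ i\<bar> \<le> l" for i
    using assms[unfolded mem_cube, rule_format, of i] by linarith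
  then have "dist x y \<le> (\<Sum>i\<in>(UNIV :: 'n set). l)"
    by (intro order_trans[OF dist_le_sum_abs] sum_mono)
  then show ?thesis by simp
qed

lemma continuous_on_cube_integrable:
  fixes f :: "real ^ 'n \<Rightarrow> real"
  shows "continuous_on (cube a l) f \<Longrightarrow> f absolutely_integrable_on cube a l"
  unfolding cube_def by (rule absolutely_integrable_continuous)

lemma bounded_mult_cube_integrable:
  fixes f g :: "real ^ 'n \<Rightarrow> real"
  assumes "f absolutely_integrable_on cube a l" "continuous_on (cube a l) g"
  shows "(\<lambda>x. g x * f x) absolutely_integrable_on cube a l"
proof -
  have "g \<in> borel_measurable (lebesgue_on (cube a l))"
    using assms(2) by (intro continuous_imp_measurable_on_sets_lebesgue) auto
  moreover have "bounded (g ` cube a l)"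
    using assms(2) compact_cube compact_continuous_image compact_imp_bounded by blast
  ultimately show ?thesis
    using absolutely_integrable_bounded_measurable_product[OF bilinear_times, of g "cube a l" f]
      assms(1) by simp
qed

section \<open>Boundary layers of a cube, and subdivision into small cubes\<close>

text \<open>The Weierstrass product inequality: a new factor lowers the product by
  \<open>t i\<close> times a number at most 1.\<close>

lemma prod_one_minus_ge:
  fixes t :: "'a \<Rightarrow> real"
  assumes "finite I" "\<And>i. i \<in> I \<Longrightarrow> 0 \<le> t i" "\<And>i. i \<in> I \<Longrightarrow> t i \<le> 1"
  shows "1 - (\<Sum>i\<in>I. t i) \<le> (\<Prod>i\<in>I. 1 - t i)"
  using assms
proof (induction I rule: finite_induct)
  case (insert i I)
  have "0 \<le> (\<Prod>j\<in>I. 1 - t j)" "(\<Prod>j\<in>I. 1 - t j) \<le> 1"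
    using insert by (auto intro!: prod_nonneg prod_le_1)
  moreover have "t i * (\<Prod>j\<in>I. 1 - t j) \<le> t i * 1"
    using insert calculation by (intro mult_left_mono) auto
  ultimately show ?case using insert by (simp add: algebra_simps)
qed simp

text \<open>The relative volume lost is at most the sum of the relative losses of side length. It
  measures both the boundary layer of a cube and the part of a cube outside a translate of
  it.\<close>

lemma measure_cube_diff_cbox_le:
  fixes a :: "real ^ 'n"
  assumes "0 < l" and sub: "cbox p q \<subseteq> cube a l" and t: "\<And>i. 0 \<le> t i"
    and side: "\<And>i. l - t i \<le> q $ i - p $ i"
  shows "measure lebesgue (cube a l - cbox p q) \<le> l ^ CARD('n) * ((\<Sum>i\<in>UNIV. t i) / l)"
proof (cases "(\<Sum>i\<in>UNIV. t i) \<le> l")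
  \<comment> \<open>The claimed bound now exceeds the volume of the whole cube; this also covers
    boxes that degenerate to the empty set.\<close>
  case False
  have "measure lebesgue (cube a l - cbox p q) \<le> measure lebesgue (cube a l)"
    by (intro measure_mono_fmeasurable) (auto intro: fmeasurableD)
  also have "\<dots> \<le> l ^ CARD('n) * ((\<Sum>i\<in>UNIV. t i) / l)"
    using False assms by (simp add: measure_cube field_simps)
  finally show ?thesis .
next
  case True
  have tl: "t i \<le> l" for i
    using True t member_le_sum[of i UNIV t] by simp
  have ne: "cbox p q \<noteq> {}"
  proof -
    have "p $ i \<le> q $ i" for i using side[of i] tl[of i] by linarith
    then have "p \<in> cbox p q" by (simp add: mem_box_cart)
    then show ?thesis by blast
  qed
  have "l ^ CARD('n) * (1 - (\<Sum>i\<in>UNIV. t i) / l) \<le> l ^ CARD('n) * (\<Prod>i\<in>UNIV. 1 - t i / l)"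
    using prod_one_minus_ge[of UNIV "\<lambda>i. t i / l"] t tl \<open>0 < l\<close>
    by (simp add: sum_divide_distrib)
  also have "\<dots> = (\<Prod>i\<in>(UNIV :: 'n set). l * (1 - t i / l))"
    by (simp add: prod.distrib)
  also have "\<dots> \<le> (\<Prod>i\<in>UNIV. q $ i - p $ i)"
    using side tl \<open>0 < l\<close> by (intro prod_mono) (simp add: algebra_simps)
  also have "\<dots> = measure lebesgue (cbox p q)"
    using ne by (simp add: content_cbox_cart)
  finally have "l ^ CARD('n) * (1 - (\<Sum>i\<in>UNIV. t i) / l) \<le> measure lebesgue (cbox p q)" .
  moreover have "measure lebesgue (cube a l - cbox p q)
      = measure lebesgue (cube a l) - measure lebesgue (cbox p q)"
    using sub by (intro measurable_measure_Diff) auto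
  ultimately show ?thesis using \<open>0 < l\<close> by (simp add: measure_cube algebra_simps)
qed

text \<open>A cover by grid cubes whose measures add up to that of the big cube suffices, so overlaps of
  the grid cubes need not be discussed.\<close>

lemma average_le_of_small_cubes:
  fixes a :: "real ^ 'n"
  assumes s: "0 < s" "s \<le> l" and h: "h absolutely_integrable_on cube a l"
    and nn: "\<And>x. x \<in> cube a l \<Longrightarrow> 0 \<le> h x"
    and small: "\<And>b r. s \<le> r \<Longrightarrow> r < 2 * s \<Longrightarrow> cube b r \<subseteq> cube a l \<Longrightarrow> average (cube b r) h \<le> e"
  shows "average (cube a l) h \<le> e"
proof -
  \<comment> \<open>Rounding down a number that is at least 1 less than halves it, so cutting each
    side into \<open>m\<close> equal pieces gives pieces of length in
    \<open>[s, 2 * s)\<close>.\<close>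
  define m where "m = nat \<lfloor>l / s\<rfloor>"
  define r where "r = l / real m"
  have ls: "1 \<le> l / s" using s by simp
  then have m_eq: "real m = of_int \<lfloor>l / s\<rfloor>"
    unfolding m_def by (simp add: of_nat_nat)
  have m1: "1 \<le> m" using ls unfolding m_def by linarith
  have "real m \<le> l / s" "l / s < real m + 1"
    unfolding m_eq by linarith+
  then have "l / s < 2 * real m" using m1 by linarith
  then have "s \<le> r" "r < 2 * s"
    using s m1 \<open>real m \<le> l / s\<close> unfolding r_def by (simp_all add: field_simps)
  then have "0 < r" using s by linarith
  define I where "I = (UNIV :: 'n set) \<rightarrow>\<^sub>E {..<m}"
  define c where "c v = (\<chi> i. a $ i + real (v i) * r)" for v :: "'n \<Rightarrow> nat"
  have finI: "finite I" unfolding I_def by (intro finite_PiE) auto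
  have cardI: "card I = m ^ CARD('n)" unfolding I_def by (simp add: card_PiE)
  have sub: "cube (c v) r \<subseteq> cube a l" if "v \<in> I" for v
  proof
    fix x assume x: "x \<in> cube (c v) r"
    show "x \<in> cube a l" unfolding mem_cube
    proof
      fix i
      have "v i < m" using that unfolding I_def by auto
      then have "(real (v i) + 1) * r \<le> real m * r"
        using \<open>0 < r\<close> by (intro mult_right_mono) auto
      also have "\<dots> = l" using m1 unfolding r_def by simp
      finally have "real (v i) * r + r \<le> l" by (simp add: algebra_simps)
      moreover have "0 \<le> real (v i) * r" using \<open>0 < r\<close> by simp
      moreover have "a $ i + real (v i) * r \<le> x $ i" "x $ i \<le> a $ i + real (v i) * r + r"
        using x[unfolded mem_cube, rule_format, of i] by (simp_all add: c_def)
      ultimately show "a $ i \<le> x $ i \<and> x $ i \<le> a $ i + l" by linarith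
    qed
  qed
  have cover: "\<exists>v\<in>I. x \<in> cube (c v) r" if x: "x \<in> cube a l" for x
  proof -
    \<comment> \<open>The minimum treats the far faces of the big cube, where the quotient is
      \<open>m\<close> and the last admissible index is \<open>m - 1\<close>.\<close>
    define v where "v i = min (m - 1) (nat \<lfloor>(x $ i - a $ i) / r\<rfloor>)" for i
    have "v \<in> I" unfolding I_def v_def using m1 by auto
    moreover have "x \<in> cube (c v) r" unfolding mem_cube
    proof
      fix i
      let ?u = "(x $ i - a $ i) / r"
      have u: "0 \<le> ?u" using x \<open>0 < r\<close> by (simp add: mem_cube)
      have "x $ i - a $ i \<le> real m * r" using x m1 unfolding r_def by (simp add: mem_cube algebra_simps)
      then have um: "?u \<le> real m" using \<open>0 < r\<close> by (simp add: field_simps)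
      have fl: "real (nat \<lfloor>?u\<rfloor>) \<le> ?u" "?u < real (nat \<lfloor>?u\<rfloor>) + 1" using u by linarith+
      have "real (v i) \<le> ?u" using fl unfolding v_def by linarith
      moreover have "?u \<le> real (v i) + 1"
        using fl um m1 unfolding v_def by (cases "m - 1 \<le> nat \<lfloor>?u\<rfloor>") (auto simp: min_def)
      ultimately have "real (v i) * r \<le> x $ i - a $ i" "x $ i - a $ i \<le> (real (v i) + 1) * r"
        using \<open>0 < r\<close> by (simp_all add: field_simps)
      then show "c v $ i \<le> x $ i \<and> x $ i \<le> c v $ i + r"
        unfolding c_def by (simp add: algebra_simps)
    qed
    ultimately show ?thesis by blast
  qed
  have int: "h absolutely_integrable_on cube (c v) r" if "v \<in> I" for v
    using set_integrable_subset[OF h _ sub[OF that]] by simp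
  have "(LINT x:cube a l|lebesgue. h x)
      \<le> integral\<^sup>L lebesgue (\<lambda>x. \<Sum>v\<in>I. indicator (cube (c v) r) x *\<^sub>R h x)"
    unfolding set_lebesgue_integral_def
  proof (intro integral_mono Bochner_Integration.integrable_sum)
    show "integrable lebesgue (\<lambda>x. indicator (cube a l) x *\<^sub>R h x)"
      using h by (simp add: set_integrable_def)
    show "integrable lebesgue (\<lambda>x. indicator (cube (c v) r) x *\<^sub>R h x)" if "v \<in> I" for v
      using int[OF that] by (simp add: set_integrable_def)
    fix x
    have nn': "0 \<le> indicator (cube (c v) r) x *\<^sub>R h x" if "v \<in> I" for v
      using nn[of x] sub[OF that] by (auto simp: indicator_def)
    show "indicator (cube a l) x *\<^sub>R h x \<le> (\<Sum>v\<in>I. indicator (cube (c v) r) x *\<^sub>R h x)"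
    proof (cases "x \<in> cube a l")
      case True
      then obtain v where "v \<in> I" "x \<in> cube (c v) r" using cover by blast
      then show ?thesis
        using True member_le_sum[of v I "\<lambda>v. indicator (cube (c v) r) x *\<^sub>R h x"] nn' finI by auto
    qed (use nn' in \<open>simp add: sum_nonneg\<close>)
  qed
  also have "\<dots> = (\<Sum>v\<in>I. LINT x:cube (c v) r|lebesgue. h x)"
    unfolding set_lebesgue_integral_def using int
    by (intro Bochner_Integration.integral_sum) (simp add: set_integrable_def)
  also have "\<dots> \<le> (\<Sum>v\<in>I. e * r ^ CARD('n))"
  proof (intro sum_mono)
    fix v assume "v \<in> I"
    then have "average (cube (c v) r) h \<le> e"
      using small \<open>s \<le> r\<close> \<open>r < 2 * s\<close> sub by blast
    then show "(LINT x:cube (c v) r|lebesgue. h x) \<le> e * r ^ CARD('n)"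
      using \<open>0 < r\<close> by (simp add: average_def measure_cube divide_le_eq)
  qed
  also have "\<dots> = e * (real m * r) ^ CARD('n)"
    by (simp add: cardI power_mult_distrib)
  also have "real m * r = l" using m1 unfolding r_def by simp
  finally show ?thesis
    using s by (simp add: average_def measure_cube divide_le_eq)
qed

subsection \<open>Cut-off functions of small mean oscillation\<close>

text \<open>The value is 0 up to distance \<open>t\<close> from the complement and 1 from distance
  \<open>2 * t\<close> on. Summed over dyadic \<open>t\<close>, these functions count the scales
  below the distance, which gives a truncated logarithm. As \<open>infdist\<close> to the empty set
  is 0, the function vanishes identically for \<open>\<Omega> = UNIV\<close>.\<close>

definition cutoff :: "(real ^ 'n) set \<Rightarrow> real \<Rightarrow> real ^ 'n \<Rightarrow> real" where
  "cutoff \<Omega> t x = max 0 (min 1 (infdist x (- \<Omega>) / t - 1))"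

lemma cutoff_range: "0 \<le> cutoff \<Omega> t x" "cutoff \<Omega> t x \<le> 1"
  by (simp_all add: cutoff_def)

lemma abs_clamp_diff_le: "\<bar>max 0 (min 1 u) - max 0 (min 1 v)\<bar> \<le> \<bar>u - v\<bar>" for u v :: real
  by (simp add: max_def min_def)

lemma cutoff_lipschitz:
  assumes "0 < t"
  shows "\<bar>cutoff \<Omega> t x - cutoff \<Omega> t y\<bar> \<le> dist x y / t"
proof -
  have "\<bar>cutoff \<Omega> t x - cutoff \<Omega> t y\<bar> \<le> \<bar>infdist x (- \<Omega>) / t - infdist y (- \<Omega>) / t\<bar>"
    unfolding cutoff_def by (rule order_trans[OF abs_clamp_diff_le]) simp
  also have "\<dots> = \<bar>infdist x (- \<Omega>) - infdist y (- \<Omega>)\<bar> / t"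
    using assms by (simp add: diff_divide_distrib[symmetric])
  also have "\<dots> \<le> dist x y / t"
    using assms infdist_triangle_abs[of x "- \<Omega>" y] by (intro divide_right_mono) auto
  finally show ?thesis .
qed

lemma continuous_on_cutoff: "0 < t \<Longrightarrow> continuous_on S (cutoff \<Omega> t)"
  unfolding cutoff_def by (intro continuous_intros) auto

lemma cutoff_nonzero_imp_ball:
  assumes "0 < t" "cutoff \<Omega> t x \<noteq> 0"
  shows "ball x t \<subseteq> \<Omega>"
proof
  fix y assume y: "y \<in> ball x t"
  have "t < infdist x (- \<Omega>)"
    using assms by (auto simp: cutoff_def max_def min_def field_simps split: if_splits)
  then show "y \<in> \<Omega>"
    using y infdist_le[of y "- \<Omega>" x] by force
qed

text \<open>The points of a cube in \<open>\<Omega>\<close> where the cut-off differs from \<open>1\<close> lie in a layer of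
  thickness \<open>2 * t\<close> along the boundary of the cube.\<close>

lemma average_one_minus_cutoff_le:
  fixes a :: "real ^ 'n"
  assumes "\<Omega> \<noteq> UNIV" "0 < t" "0 < l" "cube a l \<subseteq> \<Omega>"
  shows "average (cube a l) (\<lambda>x. 1 - cutoff \<Omega> t x) \<le> 4 * real CARD('n) * t / l"
proof -
  define Q where "Q = cube a l"
  define I where "I = cbox (\<chi> i. a $ i + 2 * t) (\<chi> i. a $ i + l - 2 * t)"
  have IQ: "I \<subseteq> Q"
  proof (unfold subset_eq Q_def mem_cube, intro ballI allI)
    fix x i assume "x \<in> I"
    then have "a $ i + 2 * t \<le> x $ i \<and> x $ i \<le> a $ i + l - 2 * t"
      unfolding I_def mem_box_cart by auto
    then show "a $ i \<le> x $ i \<and> x $ i \<le> a $ i + l" using \<open>0 < t\<close> by linarith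
  qed
  have one: "cutoff \<Omega> t x = 1" if "x \<in> I" for x
  proof -
    have "2 * t \<le> dist x y" if y: "y \<in> - \<Omega>" for y
    proof -
      have "y \<notin> cube a l" using y assms by blast
      \<comment> \<open>One coordinate separates \<open>y\<close> from the cube, and in that
        coordinate \<open>x\<close> lies at depth at least \<open>2 * t\<close>.\<close>
      then obtain i where i: "y $ i < a $ i \<or> a $ i + l < y $ i"
        unfolding mem_cube by (meson not_le)
      have "a $ i + 2 * t \<le> x $ i" "x $ i \<le> a $ i + l - 2 * t"
        using \<open>x \<in> I\<close> unfolding I_def mem_box_cart by auto
      then have "2 * t \<le> \<bar>(x - y) $ i\<bar>" using i by auto
      then show ?thesis
        using component_le_norm_cart[of "x - y" i] unfolding dist_norm by linarith
    qed
    then have "2 * t \<le> infdist x (- \<Omega>)"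
      using assms(1) unfolding infdist_def by (auto intro!: cINF_greatest)
    then show ?thesis using \<open>0 < t\<close> by (simp add: cutoff_def field_simps)
  qed
  have QI: "Q - I \<in> lmeasurable" unfolding Q_def I_def by auto
  have "average Q (\<lambda>x. 1 - cutoff \<Omega> t x) \<le> average Q (indicator (Q - I))"
  proof (rule average_mono)
    show "(\<lambda>x. 1 - cutoff \<Omega> t x) absolutely_integrable_on Q"
      unfolding Q_def using \<open>0 < t\<close>
      by (intro continuous_on_cube_integrable continuous_intros continuous_on_cutoff)
    show "(indicator (Q - I) :: real ^ 'n \<Rightarrow> real) absolutely_integrable_on Q"
      unfolding set_integrable_def using QI
      by (intro integrable_mult_indicator) (auto simp: Q_def fmeasurable_def)
    show "1 - cutoff \<Omega> t x \<le> indicator (Q - I) x" if "x \<in> Q" for x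
      using one[of x] cutoff_range[of \<Omega> t x] that by (auto simp: indicator_def)
  qed
  also have "average Q (indicator (Q - I)) = measure lebesgue (Q - I) / measure lebesgue Q"
  proof -
    have "(LINT x:Q|lebesgue. (indicator (Q - I) x :: real)) = (LINT x|lebesgue. indicator (Q - I) x)"
      unfolding set_lebesgue_integral_def
      by (intro Bochner_Integration.integral_cong) (auto simp: indicator_def)
    then show ?thesis using QI by (simp add: average_def)
  qed
  \<comment> \<open>Each coordinate loses \<open>2 * t\<close> at both of its faces, hence
    \<open>4 * t\<close>.\<close>
  also have "\<dots> \<le> (\<Sum>i\<in>(UNIV :: 'n set). 4 * t) / l"
  proof -
    have "measure lebesgue (Q - I) \<le> l ^ CARD('n) * ((\<Sum>i\<in>(UNIV :: 'n set). 4 * t) / l)"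
      unfolding Q_def I_def using assms IQ
      by (intro measure_cube_diff_cbox_le) (auto simp: Q_def I_def)
    then show ?thesis using \<open>0 < l\<close> unfolding Q_def
      by (simp add: measure_cube divide_le_eq mult.commute)
  qed
  finally show ?thesis unfolding Q_def by (simp add: mult_ac)
qed

text \<open>On cubes large against \<open>t\<close> the cut-off equals 1 except in a thin layer; on
  cubes small against \<open>t\<close> the Lipschitz bound takes over. The resulting decay away from
  \<open>l = t\<close> in both directions makes the bounds summable over dyadic
  \<open>t\<close>.\<close>

lemma osc_cutoff_le:
  fixes a :: "real ^ 'n"
  assumes "\<Omega> \<noteq> UNIV" "0 < t" "0 < l" "cube a l \<subseteq> \<Omega>"
  shows "osc (cube a l) (cutoff \<Omega> t) \<le> 8 * real CARD('n) * min (t / l) (l / t)"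
proof -
  let ?Q = "cube a l"
  have int: "cutoff \<Omega> t absolutely_integrable_on ?Q"
    using \<open>0 < t\<close> by (intro continuous_on_cube_integrable continuous_on_cutoff)
  have "osc ?Q (cutoff \<Omega> t) \<le> 2 * average ?Q (\<lambda>x. \<bar>cutoff \<Omega> t x - 1\<bar>)"
    using int \<open>0 < l\<close> by (intro osc_le) (auto simp: measure_cube)
  also have "average ?Q (\<lambda>x. \<bar>cutoff \<Omega> t x - 1\<bar>) = average ?Q (\<lambda>x. 1 - cutoff \<Omega> t x)"
    by (intro average_cong) (simp add: abs_minus_commute[of _ 1] cutoff_range)
  finally have A: "osc ?Q (cutoff \<Omega> t) \<le> 8 * real CARD('n) * (t / l)"
    using average_one_minus_cutoff_le[OF assms] by simp
  have "osc ?Q (cutoff \<Omega> t) \<le> 2 * (real CARD('n) * (l / t))"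
  proof (rule osc_le_const[where c = "cutoff \<Omega> t a"])
    fix x assume x: "x \<in> ?Q"
    have "\<bar>cutoff \<Omega> t x - cutoff \<Omega> t a\<bar> \<le> dist x a / t"
      using \<open>0 < t\<close> by (rule cutoff_lipschitz)
    also have "\<dots> \<le> real CARD('n) * l / t"
      using x \<open>0 < t\<close> \<open>0 < l\<close> by (intro divide_right_mono dist_cube_le) (auto simp: mem_cube)
    finally show "\<bar>cutoff \<Omega> t x - cutoff \<Omega> t a\<bar> \<le> real CARD('n) * (l / t)" by simp
  qed (use int \<open>0 < l\<close> in \<open>auto simp: measure_cube\<close>)
  also have "\<dots> \<le> 8 * (real CARD('n) * (l / t))"
    using \<open>0 < t\<close> \<open>0 < l\<close> by (intro mult_right_mono) auto
  finally show ?thesis using A by (simp add: min_def)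
qed

text \<open>Telescoping, since \<open>min y (1 / y)\<close> is bounded by a multiple of \<open>h (2 * y) - h y\<close> for the
  bounded function \<open>h y = y / (1 + y)\<close>.\<close>

lemma sum_min_dyadic_le:
  fixes x :: real
  assumes "0 < x"
  shows "(\<Sum>k<N. min (x * 2 ^ k) (1 / (x * 2 ^ k))) \<le> 6"
proof -
  define h :: "real \<Rightarrow> real" where "h y = y / (1 + y)" for y
  have step: "min y (1 / y) \<le> 6 * (h (2 * y) - h y)" if "0 < y" for y
  proof -
    \<comment> \<open>The denominator here is at most \<open>6\<close> for \<open>y \<le> 1\<close>
      and at most \<open>6 * y * y\<close> for \<open>y > 1\<close>, which is where the constant 6
      comes from.\<close>
    have eq: "h (2 * y) - h y = y / ((1 + 2 * y) * (1 + y))"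
      using that unfolding h_def by (simp add: divide_simps) (simp add: algebra_simps)
    show ?thesis
    proof (cases "y \<le> 1")
      case True
      have "(1 + 2 * y) * (1 + y) \<le> 3 * 2" using True that by (intro mult_mono) auto
      then have "y / 6 \<le> y / ((1 + 2 * y) * (1 + y))"
        using that by (intro divide_left_mono) (auto intro!: mult_pos_pos)
      then have "y \<le> 6 * (y / ((1 + 2 * y) * (1 + y)))" by linarith
      then show ?thesis unfolding eq by (rule min.coboundedI1)
    next
      case False
      have "(1 + 2 * y) * (1 + y) \<le> (3 * y) * (2 * y)" using False by (intro mult_mono) auto
      then have "y / ((3 * y) * (2 * y)) \<le> y / ((1 + 2 * y) * (1 + y))"
        using that by (intro divide_left_mono) (auto intro!: mult_pos_pos)
      then have "1 / y \<le> 6 * (y / ((1 + 2 * y) * (1 + y)))"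
        using that by (simp add: field_simps)
      then show ?thesis unfolding eq by (rule min.coboundedI2)
    qed
  qed
  have "(\<Sum>k<N. min (x * 2 ^ k) (1 / (x * 2 ^ k)))
      \<le> (\<Sum>k<N. 6 * (h (x * 2 ^ Suc k) - h (x * 2 ^ k)))"
    using step[of "x * 2 ^ k" for k] assms by (intro sum_mono) (simp add: mult_ac)
  also have "\<dots> = 6 * (h (x * 2 ^ N) - h x)"
    unfolding sum_distrib_left[symmetric] sum_lessThan_telescope[of "\<lambda>k. h (x * 2 ^ k)"] by simp
  also have "\<dots> \<le> 6"
  proof -
    have "0 \<le> h y" "h y \<le> 1" if "0 < y" for y
      using that by (simp_all add: h_def divide_le_eq)
    then have "0 \<le> h x" "h (x * 2 ^ N) \<le> 1" using assms by auto
    then show ?thesis by simp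
  qed
  finally show ?thesis .
qed

text \<open>The average of \<open>N\<close> cut-offs at dyadic scales: at the scale of a given cube only boundedly
  many of them oscillate, so the mean oscillation is of order \<open>1 / N\<close>.\<close>

lemma exists_small_osc_cutoff:
  fixes \<Omega> :: "(real ^ 'n) set"
  assumes "0 < \<delta>" "0 < s"
  obtains \<phi> :: "real ^ 'n \<Rightarrow> real" and \<eta> :: real
  where "0 < \<eta>" "\<And>x y. \<bar>\<phi> x - \<phi> y\<bar> \<le> dist x y / \<eta>"
    "\<And>x. 0 \<le> \<phi> x" "\<And>x. \<phi> x \<le> 1" "\<And>x. \<phi> x \<noteq> 0 \<Longrightarrow> ball x \<eta> \<subseteq> \<Omega>"
    "\<And>a l. 0 < l \<Longrightarrow> cube a l \<subseteq> \<Omega> \<Longrightarrow> osc (cube a l) \<phi> \<le> \<delta>"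
    "\<And>a l. s \<le> l \<Longrightarrow> cube a l \<subseteq> \<Omega> \<Longrightarrow> average (cube a l) (\<lambda>x. 1 - \<phi> x) \<le> \<delta>"
proof (cases "\<Omega> = UNIV")
  \<comment> \<open>There is no boundary to stay away from, and \<open>cutoff\<close> would be
    identically 0, so the constant 1 is used.\<close>
  case True
  show ?thesis
  proof (rule that[of 1 "\<lambda>x. 1"])
    fix a :: "real ^ 'n" and l :: real
    assume "0 < l"
    then have "average (cube a l) (\<lambda>x. 1) = 1"
      by (intro average_const) (auto simp: measure_cube)
    then show "osc (cube a l) (\<lambda>x. 1) \<le> \<delta>"
      using \<open>0 < \<delta>\<close> average_cmult[of "cube a l" 0 "\<lambda>x. 0"] by (simp add: osc_def)
  next
    fix a :: "real ^ 'n" and l :: real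
    show "average (cube a l) (\<lambda>x. 1 - 1) \<le> \<delta>"
      using \<open>0 < \<delta>\<close> average_cmult[of "cube a l" 0 "\<lambda>x. 0"] by simp
  qed (use True in auto)
next
  case False
  let ?n = "real CARD('n)"
  \<comment> \<open>The constant is \<open>48 = 8 * 6\<close>, with 8 from
    \<open>osc_cutoff_le\<close> and 6 from the dyadic sum.\<close>
  obtain N :: nat where N: "48 * ?n / \<delta> < real N"
    using reals_Archimedean2 by blast
  have "0 < 48 * ?n / \<delta>" using \<open>0 < \<delta>\<close> by simp
  then have N0: "0 < real N" using N by linarith
  \<comment> \<open>All scales \<open>\<eta> * 2 ^ k\<close> with \<open>k < N\<close> stay below
    \<open>\<delta> * s / (4 * ?n)\<close>, so on cubes of side at least \<open>s\<close> every
    layer takes up at most the fraction \<open>\<delta>\<close>.\<close>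
  define \<eta> where "\<eta> = \<delta> * s / (4 * ?n * 2 ^ N)"
  have \<eta>: "0 < \<eta>" using assms unfolding \<eta>_def by simp
  define t where "t k = \<eta> * 2 ^ k" for k :: nat
  have t: "0 < t k" "\<eta> \<le> t k" for k
    using \<eta> unfolding t_def by simp_all
  define \<phi> where "\<phi> x = (1 / real N) * (\<Sum>k<N. cutoff \<Omega> (t k) x)" for x
  show ?thesis
  proof (rule that[of \<eta> \<phi>])
    show "0 < \<eta>" by (rule \<eta>)
    show "\<bar>\<phi> x - \<phi> y\<bar> \<le> dist x y / \<eta>" for x y
    proof -
      have "\<bar>\<phi> x - \<phi> y\<bar> = (1 / real N) * \<bar>\<Sum>k<N. cutoff \<Omega> (t k) x - cutoff \<Omega> (t k) y\<bar>"
        unfolding \<phi>_def right_diff_distrib[symmetric] sum_subtractf abs_mult by simp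
      also have "\<dots> \<le> (1 / real N) * (\<Sum>k<N. dist x y / \<eta>)"
      proof (intro mult_left_mono order_trans[OF sum_abs] sum_mono)
        fix k
        have "\<bar>cutoff \<Omega> (t k) x - cutoff \<Omega> (t k) y\<bar> \<le> dist x y / t k"
          using t(1) by (rule cutoff_lipschitz)
        also have "\<dots> \<le> dist x y / \<eta>" using t \<eta> by (intro divide_left_mono) auto
        finally show "\<bar>cutoff \<Omega> (t k) x - cutoff \<Omega> (t k) y\<bar> \<le> dist x y / \<eta>" .
      qed simp
      finally show ?thesis using N0 by simp
    qed
    show "0 \<le> \<phi> x" for x
      unfolding \<phi>_def by (intro mult_nonneg_nonneg sum_nonneg cutoff_range) simp
    show "\<phi> x \<le> 1" for x
    proof -
      have "(\<Sum>k<N. cutoff \<Omega> (t k) x) \<le> (\<Sum>k<N. 1)" by (intro sum_mono cutoff_range)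
      then show ?thesis unfolding \<phi>_def using N0 by simp
    qed
    show "ball x \<eta> \<subseteq> \<Omega>" if "\<phi> x \<noteq> 0" for x
    proof -
      have "\<exists>k. cutoff \<Omega> (t k) x \<noteq> 0"
        using that by (rule contrapos_np) (simp add: \<phi>_def)
      then obtain k where "cutoff \<Omega> (t k) x \<noteq> 0" ..
      then show ?thesis
        using cutoff_nonzero_imp_ball[OF t(1), of \<Omega> k x] t(2)[of k] subset_ball by blast
    qed
    fix a :: "real ^ 'n" and l :: real
    have int: "cutoff \<Omega> (t k) absolutely_integrable_on cube a l" for k
      using t by (intro continuous_on_cube_integrable continuous_on_cutoff)
    show "osc (cube a l) \<phi> \<le> \<delta>" if "0 < l" "cube a l \<subseteq> \<Omega>"
    proof -
      have "osc (cube a l) \<phi> = (1 / real N) * osc (cube a l) (\<lambda>x. \<Sum>k<N. cutoff \<Omega> (t k) x)"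
        unfolding \<phi>_def osc_cmult by simp
      also have "\<dots> \<le> (1 / real N) * (\<Sum>k<N. osc (cube a l) (cutoff \<Omega> (t k)))"
        using int that by (intro mult_left_mono osc_sum) (auto simp: measure_cube)
      also have "\<dots> \<le> (1 / real N) * (\<Sum>k<N. 8 * ?n * min (\<eta> / l * 2 ^ k) (1 / (\<eta> / l * 2 ^ k)))"
      proof (intro mult_left_mono sum_mono)
        fix k
        have "osc (cube a l) (cutoff \<Omega> (t k)) \<le> 8 * ?n * min (t k / l) (l / t k)"
          using False t that by (intro osc_cutoff_le)
        then show "osc (cube a l) (cutoff \<Omega> (t k))
            \<le> 8 * ?n * min (\<eta> / l * 2 ^ k) (1 / (\<eta> / l * 2 ^ k))"
          by (simp add: t_def)
      qed simp
      also have "\<dots> \<le> (1 / real N) * (8 * ?n * 6)"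
        unfolding sum_distrib_left[symmetric] using \<eta> that
        by (intro mult_left_mono sum_min_dyadic_le) auto
      also have "\<dots> \<le> \<delta>" using N N0 \<open>0 < \<delta>\<close> by (simp add: field_simps)
      finally show ?thesis .
    qed
    show "average (cube a l) (\<lambda>x. 1 - \<phi> x) \<le> \<delta>" if "s \<le> l" "cube a l \<subseteq> \<Omega>"
    proof -
      have "0 < l" using that assms by simp
      have "average (cube a l) (\<lambda>x. 1 - \<phi> x)
          = average (cube a l) (\<lambda>x. (1 / real N) * (\<Sum>k<N. 1 - cutoff \<Omega> (t k) x))"
        using N0 by (intro average_cong) (simp add: \<phi>_def sum_subtractf field_simps)
      also have "\<dots> = (1 / real N) * (\<Sum>k<N. average (cube a l) (\<lambda>x. 1 - cutoff \<Omega> (t k) x))"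
        unfolding average_cmult using int
        by (subst average_sum) (auto intro!: absolutely_integrable_on_const)
      also have "\<dots> \<le> (1 / real N) * (\<Sum>k<N. \<delta>)"
      proof (intro mult_left_mono sum_mono)
        fix k assume "k \<in> {..<N}"
        then have "t k \<le> \<eta> * 2 ^ N" using \<eta> unfolding t_def by simp
        then have "4 * ?n * t k / l \<le> 4 * ?n * (\<eta> * 2 ^ N) / l"
          using \<open>0 < l\<close> by (intro divide_right_mono mult_left_mono) auto
        also have "\<dots> = \<delta> * s / l" unfolding \<eta>_def by simp
        also have "\<dots> \<le> \<delta>" using \<open>0 < l\<close> that \<open>0 < \<delta>\<close> by (simp add: divide_le_eq)
        finally show "average (cube a l) (\<lambda>x. 1 - cutoff \<Omega> (t k) x) \<le> \<delta>"
          using average_one_minus_cutoff_le[OF False t(1) \<open>0 < l\<close> that(2), of k] by linarith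
      qed simp
      also have "\<dots> = \<delta>" using N0 by simp
      finally show ?thesis .
    qed
  qed
qed

subsection \<open>Approximation of bounded functions\<close>

lemma abs_set_integral_le:
  fixes f :: "real ^ 'n \<Rightarrow> real"
  assumes "S \<in> lmeasurable" "f absolutely_integrable_on S" "\<And>x. x \<in> S \<Longrightarrow> \<bar>f x\<bar> \<le> M"
  shows "\<bar>LINT x:S|lebesgue. f x\<bar> \<le> M * measure lebesgue S"
proof -
  have c: "(LINT x:S|lebesgue. c) = c * measure lebesgue S" for c :: real
    using assms(1) by (simp add: set_lebesgue_integral_def fmeasurable_def)
  have "(LINT x:S|lebesgue. f x) \<le> (LINT x:S|lebesgue. M)"
    using assms by (intro set_integral_mono absolutely_integrable_on_const) (auto simp: abs_le_iff)
  moreover have "(LINT x:S|lebesgue. - M) \<le> (LINT x:S|lebesgue. f x)"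
    using assms by (intro set_integral_mono absolutely_integrable_on_const) (auto simp: abs_le_iff minus_le_iff)
  ultimately show ?thesis unfolding c by (simp add: abs_le_iff)
qed

text \<open>The integrals over the two translates differ only through the parts outside their
  intersection, whose volume is linear in the displacement. This makes averaging at a fixed scale
  Lipschitz.\<close>

lemma abs_average_cube_diff_le:
  fixes x y :: "real ^ 'n"
  assumes "0 < r"
    and f: "f absolutely_integrable_on cube x r" "f absolutely_integrable_on cube y r"
    and M: "0 \<le> M" "\<And>z. z \<in> cube x r \<union> cube y r \<Longrightarrow> \<bar>f z\<bar> \<le> M"
  shows "\<bar>average (cube x r) f - average (cube y r) f\<bar> \<le> 2 * M * real CARD('n) / r * dist x y"
proof -
  \<comment> \<open>The intersection of the two cubes; it may be empty, and the volume estimate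
    still applies.\<close>
  define I where "I = cbox (\<chi> i. max (x $ i) (y $ i)) (\<chi> i. min (x $ i) (y $ i) + r)"
  define d where "d = (\<Sum>i\<in>UNIV. \<bar>x $ i - y $ i\<bar>)"
  have key: "\<bar>(LINT z:cube w r|lebesgue. f z) - (LINT z:I|lebesgue. f z)\<bar> \<le> M * (r ^ CARD('n) * (d / r))"
    if w: "w = x \<or> w = y" for w
  proof -
    have sub: "I \<subseteq> cube w r"
    proof (unfold subset_eq mem_cube, intro ballI allI)
      fix z i assume "z \<in> I"
      then have "max (x $ i) (y $ i) \<le> z $ i \<and> z $ i \<le> min (x $ i) (y $ i) + r"
        unfolding I_def mem_box_cart by auto
      then show "w $ i \<le> z $ i \<and> z $ i \<le> w $ i + r" using w by auto
    qed
    have I: "I \<in> lmeasurable" unfolding I_def by simp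
    have fw: "f absolutely_integrable_on cube w r" using f w by auto
    have int: "f absolutely_integrable_on I" "f absolutely_integrable_on (cube w r - I)"
      using I sub by (auto intro!: set_integrable_subset[OF fw] fmeasurableD fmeasurable_Diff)
    have "(LINT z:I \<union> (cube w r - I)|lebesgue. f z)
        = (LINT z:I|lebesgue. f z) + (LINT z:cube w r - I|lebesgue. f z)"
      using int by (intro set_integral_Un) auto
    moreover have "I \<union> (cube w r - I) = cube w r" using sub by blast
    ultimately have "\<bar>(LINT z:cube w r|lebesgue. f z) - (LINT z:I|lebesgue. f z)\<bar>
        = \<bar>LINT z:cube w r - I|lebesgue. f z\<bar>" by simp
    also have "\<dots> \<le> M * measure lebesgue (cube w r - I)"
      using int I M(2) w by (intro abs_set_integral_le) (auto intro: fmeasurable_Diff fmeasurableD)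
    also have "\<dots> \<le> M * (r ^ CARD('n) * (d / r))"
      unfolding d_def using \<open>0 < r\<close> sub M(1) unfolding I_def
      by (intro mult_left_mono measure_cube_diff_cbox_le) auto
    finally show ?thesis .
  qed
  have via: "\<bar>a - b\<bar> \<le> B + B" if "\<bar>a - c\<bar> \<le> B" "\<bar>b - c\<bar> \<le> B" for a b c B :: real
    using that by linarith
  have "\<bar>(LINT z:cube x r|lebesgue. f z) - (LINT z:cube y r|lebesgue. f z)\<bar>
      \<le> M * (r ^ CARD('n) * (d / r)) + M * (r ^ CARD('n) * (d / r))"
    by (rule via[OF key[OF disjI1[OF refl]] key[OF disjI2[OF refl]]])
  also have "\<dots> = 2 * M * (d / r) * r ^ CARD('n)" by simp
  finally have "\<bar>(LINT z:cube x r|lebesgue. f z) - (LINT z:cube y r|lebesgue. f z)\<bar>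
      \<le> 2 * M * (d / r) * r ^ CARD('n)" .
  then have "\<bar>(LINT z:cube x r|lebesgue. f z) - (LINT z:cube y r|lebesgue. f z)\<bar> / r ^ CARD('n)
      \<le> 2 * M * (d / r)"
    using \<open>0 < r\<close> by (simp add: divide_le_eq)
  then have "\<bar>average (cube x r) f - average (cube y r) f\<bar> \<le> 2 * M * (d / r)"
    using \<open>0 < r\<close>
    by (simp add: average_def measure_cube diff_divide_distrib[symmetric])
  also have "\<dots> \<le> 2 * M * ((real CARD('n) * dist x y) / r)"
    unfolding d_def using \<open>0 < r\<close> M(1)
    by (intro mult_left_mono divide_right_mono sum_abs_le_dist) auto
  finally show ?thesis by simp
qed

text \<open>The approximant is \<open>\<phi> * u\<close>, where \<open>\<phi>\<close> is a cut-off of small mean oscillation vanishing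
  within distance \<open>\<eta>\<close> of the complement and \<open>u x\<close> is the average of \<open>f\<close> over a cube with corner \<open>x\<close>
  whose side is much smaller than \<open>\<eta>\<close>. The error splits as
  \<open>f - \<phi> * u = (1 - \<phi>) * f + \<phi> * (f - u)\<close>.\<close>

lemma approx_bounded_by_Lip_b0:
  fixes \<Omega> :: "(real ^ 'n) set" and f :: "real ^ 'n \<Rightarrow> real"
  assumes "open \<Omega>" "0 < s" "0 < e" "0 < M"
    and int: "\<And>a l. 0 < l \<Longrightarrow> cube a l \<subseteq> \<Omega> \<Longrightarrow> f absolutely_integrable_on cube a l"
    and M: "\<And>x. \<bar>f x\<bar> \<le> M"
    and osc: "\<And>a l. 0 < l \<Longrightarrow> l < s \<Longrightarrow> cube a l \<subseteq> \<Omega> \<Longrightarrow> osc (cube a l) f \<le> e"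
  obtains g where "g \<in> Lip_b0 \<Omega>"
    "\<And>a l. 0 < l \<Longrightarrow> l < s \<Longrightarrow> cube a l \<subseteq> \<Omega> \<Longrightarrow>
       osc (cube a l) (\<lambda>x. f x - g x) \<le> 14 * 4 ^ CARD('n) * e"
    "\<And>a l. s \<le> l \<Longrightarrow> cube a l \<subseteq> \<Omega> \<Longrightarrow>
       average (cube a l) (\<lambda>x. \<bar>f x - g x\<bar>) \<le> 3 * 4 ^ CARD('n) * e"
proof -
  let ?n = "real CARD('n)"
  define p :: real where "p = 4 ^ CARD('n)"
  have p: "1 \<le> p" unfolding p_def by simp
  \<comment> \<open>In the product estimates the oscillation of \<open>\<phi>\<close> and the
    average of \<open>1 - \<phi>\<close> are multiplied by \<open>M\<close> or
    \<open>2 * M\<close>.\<close>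
  have "0 < e / M" using assms by simp
  then obtain \<phi> \<eta> where \<eta>: "0 < \<eta>"
    and \<phi>lip: "\<And>x y. \<bar>\<phi> x - \<phi> y\<bar> \<le> dist x y / \<eta>"
    and \<phi>0: "\<And>x. 0 \<le> \<phi> x" and \<phi>1: "\<And>x. \<phi> x \<le> 1"
    and \<phi>supp: "\<And>x. \<phi> x \<noteq> 0 \<Longrightarrow> ball x \<eta> \<subseteq> \<Omega>"
    and \<phi>osc: "\<And>a l. 0 < l \<Longrightarrow> cube a l \<subseteq> \<Omega> \<Longrightarrow> osc (cube a l) \<phi> \<le> e / M"
    and \<phi>av: "\<And>a l. s \<le> l \<Longrightarrow> cube a l \<subseteq> \<Omega> \<Longrightarrow> average (cube a l) (\<lambda>x. 1 - \<phi> x) \<le> e / M"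
    using exists_small_osc_cutoff[of "e / M" s \<Omega>] \<open>0 < s\<close> by metis
  \<comment> \<open>Cubes of side at most \<open>4 * r\<close> then have diameter at most
    \<open>\<eta> / 4\<close>, so they stay well inside \<open>\<Omega>\<close> when they meet the
    set where \<open>\<phi>\<close> is nonzero. Since \<open>4 * r \<le> s\<close>, those of side
    below \<open>4 * r\<close> are also subject to the hypothesis on the oscillation of
    \<open>f\<close>.\<close>
  define r where "r = min (\<eta> / (16 * ?n)) (s / 4)"
  have r: "0 < r" "4 * r \<le> s" using \<eta> \<open>0 < s\<close> unfolding r_def by auto
  have "r \<le> \<eta> / (16 * ?n)" unfolding r_def by simp
  then have rn: "16 * (?n * r) \<le> \<eta>" by (simp add: field_simps)
  define u where "u x = average (cube x r) f" for x
  \<comment> \<open>On \<open>T\<close> the averages defining \<open>u\<close> only see points of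
    \<open>\<Omega>\<close>; elsewhere nothing is claimed about \<open>u\<close>.\<close>
  define T where "T = {x. ball x (\<eta> / 2) \<subseteq> \<Omega>}"
  have cubeT: "cube x r \<subseteq> \<Omega>" if "x \<in> T" for x
  proof
    fix y assume "y \<in> cube x r"
    moreover have "x \<in> cube x r" using r by (simp add: mem_cube)
    ultimately have "dist x y \<le> ?n * r" by (intro dist_cube_le)
    also have "\<dots> < \<eta> / 2" using rn \<eta> by linarith
    finally show "y \<in> \<Omega>" using that unfolding T_def by auto
  qed
  have uM: "\<bar>u x\<bar> \<le> M" if "x \<in> T" for x
    unfolding u_def using cubeT[OF that] r M int by (intro abs_average_le_const) (auto simp: measure_cube)
  have ulip: "\<bar>u x - u y\<bar> \<le> 2 * M * ?n / r * dist x y" if "x \<in> T" "y \<in> T" for x y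
    unfolding u_def using cubeT that r M int \<open>0 < M\<close> by (intro abs_average_cube_diff_le) auto
  have ucont: "continuous_on T u"
  proof -
    have "(2 * M * ?n / r)-lipschitz_on T u"
      using ulip r \<open>0 < M\<close> by (intro lipschitz_onI) (auto simp: dist_real_def)
    then show ?thesis by (rule lipschitz_on_continuous_on)
  qed
  have near: "ball y (\<eta> / 2) \<subseteq> \<Omega>" "y \<in> T" if "\<phi> x \<noteq> 0" "dist x y \<le> \<eta> / 2" for x y
  proof -
    have "ball y (\<eta> / 2) \<subseteq> ball x \<eta>"
    proof
      fix z assume "z \<in> ball y (\<eta> / 2)"
      then show "z \<in> ball x \<eta>" using that(2) dist_triangle[of x z y] by auto
    qed
    then show "ball y (\<eta> / 2) \<subseteq> \<Omega>" using \<phi>supp[OF that(1)] by blast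
    then show "y \<in> T" by (simp add: T_def)
  qed
  have suppT: "x \<in> T" if "\<phi> x \<noteq> 0" for x using near(2)[of x x] that \<eta> by simp
  define g where "g x = \<phi> x * u x" for x
  have gM: "\<bar>g x\<bar> \<le> M" for x
  proof (cases "\<phi> x = 0")
    case False
    have "\<bar>g x\<bar> = \<phi> x * \<bar>u x\<bar>" unfolding g_def using \<phi>0[of x] by (simp add: abs_mult)
    also have "\<dots> \<le> 1 * M" using \<phi>0 \<phi>1 uM suppT False \<open>0 < M\<close> by (intro mult_mono) auto
    finally show ?thesis by simp
  qed (use \<open>0 < M\<close> in \<open>simp add: g_def\<close>)
  define L where "L = M / \<eta> + 2 * M * ?n / r"
  have L0: "0 \<le> 2 * M * ?n / r" "0 \<le> M / \<eta>" using \<open>0 < M\<close> r \<eta> by simp_all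
  \<comment> \<open>Only \<open>x\<close> is known to lie in \<open>T\<close>. If \<open>y\<close>
    does not, then \<open>\<phi> y = 0\<close> and the uncontrolled value \<open>u y\<close> drops
    out of the splitting below.\<close>
  have glip1: "\<bar>g x - g y\<bar> \<le> L * dist x y" if "\<phi> x \<noteq> 0" for x y
  proof -
    have xT: "x \<in> T" using suppT that by blast
    have 1: "\<bar>\<phi> x - \<phi> y\<bar> * \<bar>u x\<bar> \<le> (dist x y / \<eta>) * M"
      using \<phi>lip uM[OF xT] \<eta> by (intro mult_mono) auto
    have 2: "\<phi> y * \<bar>u x - u y\<bar> \<le> 2 * M * ?n / r * dist x y"
    proof (cases "\<phi> y = 0")
      case False
      have "\<phi> y * \<bar>u x - u y\<bar> \<le> 1 * (2 * M * ?n / r * dist x y)"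
        using \<phi>1 ulip[OF xT suppT[OF False]] by (intro mult_mono) auto
      then show ?thesis by simp
    qed (use mult_nonneg_nonneg[OF L0(1), of "dist x y"] in simp)
    have "\<bar>g x - g y\<bar> = \<bar>(\<phi> x - \<phi> y) * u x + \<phi> y * (u x - u y)\<bar>"
      unfolding g_def by (simp add: algebra_simps)
    also have "\<dots> \<le> \<bar>\<phi> x - \<phi> y\<bar> * \<bar>u x\<bar> + \<phi> y * \<bar>u x - u y\<bar>"
      using abs_triangle_ineq[of "(\<phi> x - \<phi> y) * u x" "\<phi> y * (u x - u y)"] \<phi>0[of y]
      by (simp add: abs_mult)
    also have "\<dots> \<le> (dist x y / \<eta>) * M + 2 * M * ?n / r * dist x y" by (intro add_mono 1 2)
    also have "\<dots> = L * dist x y" unfolding L_def by (simp add: algebra_simps)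
    finally show ?thesis .
  qed
  have glip: "\<bar>g x - g y\<bar> \<le> L * dist x y" for x y
  proof (cases "\<phi> x = 0 \<and> \<phi> y = 0")
    case True
    then show ?thesis using L0 by (simp add: g_def L_def)
  next
    case False
    then show ?thesis
      using glip1[of x y] glip1[of y x] by (auto simp: dist_commute abs_minus_commute)
  qed
  have gL: "L-lipschitz_on S g" for S
    using glip L0 by (intro lipschitz_onI) (auto simp: dist_real_def L_def)
  \<comment> \<open>Points where \<open>g\<close> is nonzero have distance at least
    \<open>\<eta>\<close> from the frontier; passing to the closure gives up half of this. Bounding
    the infimum from below also covers an empty support or frontier.\<close>
  have "\<eta> / 2 \<le> dist x y" if x: "x \<in> supp_on \<Omega> g" and y: "y \<in> frontier \<Omega>" for x y
  proof -
    have "x \<in> closure {x \<in> \<Omega>. g x \<noteq> 0}" using x unfolding supp_on_def by blast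
    then have "\<exists>x'\<in>{x \<in> \<Omega>. g x \<noteq> 0}. dist x' x < \<eta> / 2"
      unfolding closure_approachable using half_gt_zero[OF \<eta>] by blast
    then obtain x' where x': "g x' \<noteq> 0" "dist x' x < \<eta> / 2" by blast
    then have "ball x' \<eta> \<subseteq> \<Omega>" using \<phi>supp unfolding g_def by auto
    moreover have "y \<notin> \<Omega>" using y \<open>open \<Omega>\<close> by (simp add: frontier_def interior_open)
    ultimately have "\<eta> \<le> dist x' y" by (meson in_mono mem_ball not_le)
    then show ?thesis using x'(2) dist_triangle[of x' y x] by linarith
  qed
  then have "ennreal (\<eta> / 2) \<le> set_edist (supp_on \<Omega> g) (frontier \<Omega>)"
    unfolding set_edist_def by (intro INF_greatest ennreal_leI)
  then have "0 < set_edist (supp_on \<Omega> g) (frontier \<Omega>)"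
    by (rule less_le_trans[rotated]) (use \<eta> in simp)
  moreover have "bounded (g ` \<Omega>)" using gM by (auto simp: bounded_iff)
  ultimately have g0: "g \<in> Lip_b0 \<Omega>"
    unfolding Lip_b0_def Lip_b_def using gL by blast

  \<comment> \<open>For \<open>x\<close> in the cube, the averaging cube at \<open>x\<close> has
    side \<open>r \<le> l\<close> and so lies in the doubled cube with the same corner
    \<open>a\<close>. The side ratio is below 4, which yields the factor \<open>p\<close> when both
    averages of \<open>f\<close> are compared.\<close>
  have loc: "cube a (2 * l) \<subseteq> \<Omega> \<and> cube a l \<subseteq> T \<and>
      (\<forall>x\<in>cube a l. \<bar>u x - average (cube a (2 * l)) f\<bar> \<le> p * e)"
    if l: "r \<le> l" "l < 2 * r" and x0: "x0 \<in> cube a l" "\<phi> x0 \<noteq> 0" for a l x0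
  proof -
    have "0 < l" using r l by linarith
    have nl: "?n * (2 * l) \<le> \<eta> / 2"
    proof -
      have "?n * (2 * l) \<le> ?n * (4 * r)" using l by (intro mult_left_mono) auto
      then show ?thesis using rn \<eta> by linarith
    qed
    have sub: "cube a l \<subseteq> cube a (2 * l)" using \<open>0 < l\<close> by (intro cube_mono) simp
    have d: "dist x0 y \<le> \<eta> / 2" if "y \<in> cube a (2 * l)" for y
      using dist_cube_le[OF _ that, of x0] x0(1) sub nl by fastforce
    have big: "cube a (2 * l) \<subseteq> \<Omega>" "cube a (2 * l) \<subseteq> T"
    proof -
      show "cube a (2 * l) \<subseteq> T" using near(2)[OF x0(2)] d by blast
      then show "cube a (2 * l) \<subseteq> \<Omega>" unfolding T_def using \<eta> by fastforce
    qed
    have fb: "f absolutely_integrable_on cube a (2 * l)" using int big \<open>0 < l\<close> by auto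
    let ?c = "average (cube a (2 * l)) f"
    have "\<bar>u x - ?c\<bar> \<le> p * e" if x: "x \<in> cube a l" for x
    proof -
      have xs: "cube x r \<subseteq> cube a (2 * l)"
      proof (unfold subset_eq mem_cube, intro ballI allI)
        fix z i assume "z \<in> cube x r"
        then have "x $ i \<le> z $ i \<and> z $ i \<le> x $ i + r" by (simp add: mem_cube)
        moreover have "a $ i \<le> x $ i \<and> x $ i \<le> a $ i + l" using x by (simp add: mem_cube)
        ultimately show "a $ i \<le> z $ i \<and> z $ i \<le> a $ i + 2 * l" using l by linarith
      qed
      have fx: "f absolutely_integrable_on cube x r"
        using set_integrable_subset[OF fb _ xs] by simp
      have "\<bar>u x - ?c\<bar> \<le> average (cube x r) (\<lambda>z. \<bar>f z - ?c\<bar>)"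
        unfolding u_def using r fx by (intro abs_average_minus_le) (auto simp: measure_cube)
      also have "\<dots> \<le> measure lebesgue (cube a (2 * l)) / measure lebesgue (cube x r) *
          average (cube a (2 * l)) (\<lambda>z. \<bar>f z - ?c\<bar>)"
        using xs r fb
        by (intro average_subset_le absolutely_integrable_on_abs_minus_const) (auto simp: measure_cube)
      also have "\<dots> = (2 * l / r) ^ CARD('n) * osc (cube a (2 * l)) f"
        using r \<open>0 < l\<close> by (simp add: measure_cube osc_def power_divide)
      also have "\<dots> \<le> p * e" unfolding p_def
      proof (intro mult_mono power_mono)
        show "2 * l / r \<le> 4" using l r by (simp add: divide_le_eq)
        show "osc (cube a (2 * l)) f \<le> e" using big l r \<open>0 < l\<close> by (intro local.osc) auto
      qed (use r \<open>0 < l\<close> osc_nonneg in auto)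
      finally show ?thesis .
    qed
    then show ?thesis using big sub by blast
  qed

  \<comment> \<open>This is \<open>\<phi> * (f - u)\<close>, written through \<open>g\<close>
    because \<open>g\<close> is continuous everywhere.\<close>
  define h where "h x = \<phi> x * f x - g x" for x
  have h0: "h x = 0" if "\<phi> x = 0" for x using that by (simp add: h_def g_def)
  have \<phi>cont: "continuous_on S \<phi>" for S
  proof -
    have "(1 / \<eta>)-lipschitz_on S \<phi>"
      using \<phi>lip \<eta> by (intro lipschitz_onI) (auto simp: dist_real_def)
    then show ?thesis by (rule lipschitz_on_continuous_on)
  qed
  have \<phi>int: "\<phi> absolutely_integrable_on cube a l" for a l
    by (intro continuous_on_cube_integrable \<phi>cont)
  have gint: "g absolutely_integrable_on cube a l" for a l
    by (intro continuous_on_cube_integrable lipschitz_on_continuous_on[OF gL])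
  have hint: "h absolutely_integrable_on cube a l" if "0 < l" "cube a l \<subseteq> \<Omega>" for a l
    unfolding h_def using that int gint
    by (intro set_integral_diff bounded_mult_cube_integrable \<phi>cont) auto
  \<comment> \<open>Subdivision leaves cubes of side in \<open>[r, 2 * r)\<close>. Either
    \<open>\<phi>\<close> vanishes on such a cube, or \<open>loc\<close> applies and
    \<open>f\<close> and \<open>u\<close> are both close to one mean, each costing
    \<open>p * e\<close>.\<close>
  have hav: "average (cube a l) (\<lambda>x. \<bar>h x\<bar>) \<le> 2 * p * e" if l: "r \<le> l" "cube a l \<subseteq> \<Omega>" for a l
  proof (rule average_le_of_small_cubes[OF r(1) l(1)])
    have "0 < l" using r l by linarith
    then show "(\<lambda>x. \<bar>h x\<bar>) absolutely_integrable_on cube a l"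
      using hint l by (intro set_integrable_abs) auto
    fix b k assume k: "r \<le> k" "k < 2 * r" "cube b k \<subseteq> cube a l"
    have "0 < k" using r k by linarith
    have kO: "cube b k \<subseteq> \<Omega>" using k l by blast
    show "average (cube b k) (\<lambda>x. \<bar>h x\<bar>) \<le> 2 * p * e"
    proof (cases "\<exists>x0\<in>cube b k. \<phi> x0 \<noteq> 0")
      case False
      then have "average (cube b k) (\<lambda>x. \<bar>h x\<bar>) \<le> 0"
        using \<open>0 < k\<close> hint kO
        by (intro average_le_const set_integrable_abs) (auto simp: measure_cube h0)
      also have "0 \<le> 2 * p * e" using p \<open>0 < e\<close> by simp
      finally show ?thesis .
    next
      case True
      then obtain x0 where x0: "x0 \<in> cube b k" "\<phi> x0 \<noteq> 0" by blast
      let ?B = "cube b (2 * k)"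
      let ?c = "average ?B f"
      have B: "?B \<subseteq> \<Omega>" and uc: "\<And>x. x \<in> cube b k \<Longrightarrow> \<bar>u x - ?c\<bar> \<le> p * e"
        using loc[OF k(1,2) x0] by auto
      have fB: "f absolutely_integrable_on ?B" using int B \<open>0 < k\<close> by auto
      have fk: "f absolutely_integrable_on cube b k" using int kO \<open>0 < k\<close> by auto
      have "average (cube b k) (\<lambda>x. \<bar>h x\<bar>) \<le> average (cube b k) (\<lambda>x. \<bar>f x - ?c\<bar> + p * e)"
      proof (rule average_mono)
        show "(\<lambda>x. \<bar>h x\<bar>) absolutely_integrable_on cube b k"
          using hint kO \<open>0 < k\<close> by (intro set_integrable_abs) auto
        show "(\<lambda>x. \<bar>f x - ?c\<bar> + p * e) absolutely_integrable_on cube b k"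
          using fk by (intro set_integral_add absolutely_integrable_on_abs_minus_const
              absolutely_integrable_on_const) auto
        fix x assume x: "x \<in> cube b k"
        have "\<bar>h x\<bar> = \<phi> x * \<bar>f x - u x\<bar>"
          unfolding h_def g_def right_diff_distrib[symmetric] abs_mult using \<phi>0[of x] by simp
        also have "\<dots> \<le> 1 * \<bar>f x - u x\<bar>" using \<phi>1 by (intro mult_right_mono) auto
        also have "\<dots> \<le> \<bar>f x - ?c\<bar> + \<bar>u x - ?c\<bar>" by simp
        also have "\<dots> \<le> \<bar>f x - ?c\<bar> + p * e" using uc[OF x] by (rule add_left_mono)
        finally show "\<bar>h x\<bar> \<le> \<bar>f x - ?c\<bar> + p * e" .
      qed
      also have "\<dots> = average (cube b k) (\<lambda>x. \<bar>f x - ?c\<bar>) + p * e"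
        using fk \<open>0 < k\<close>
        by (simp add: average_add average_const absolutely_integrable_on_const
            absolutely_integrable_on_abs_minus_const measure_cube_pos)
      also have "average (cube b k) (\<lambda>x. \<bar>f x - ?c\<bar>)
          \<le> measure lebesgue ?B / measure lebesgue (cube b k) * average ?B (\<lambda>x. \<bar>f x - ?c\<bar>)"
        using \<open>0 < k\<close> fB
        by (intro average_subset_le absolutely_integrable_on_abs_minus_const cube_mono)
           (auto simp: measure_cube)
      also have "\<dots> = 2 ^ CARD('n) * osc ?B f"
        using \<open>0 < k\<close> by (simp add: measure_cube osc_def power_mult_distrib)
      also have "\<dots> \<le> p * e" unfolding p_def
      proof (intro mult_mono)
        show "osc ?B f \<le> e" using B k r \<open>0 < k\<close> by (intro local.osc) auto
      qed (use osc_nonneg in \<open>auto intro: power_mono\<close>)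
      finally show ?thesis by (simp add: mult_ac)
    qed
  qed simp
  \<comment> \<open>Large cubes follow from \<open>hav\<close>. Below side \<open>r\<close> the
    function \<open>u\<close> is nearly constant and \<open>f\<close> oscillates little, so the
    product rule gives \<open>2 * (2 * e + e + 2 * p * e)\<close>, at most
    \<open>10 * p * e\<close>.\<close>
  have hosc: "osc (cube a l) h \<le> 10 * p * e" if l: "0 < l" "cube a l \<subseteq> \<Omega>" for a l
  proof (cases "r \<le> l")
    case True
    have "osc (cube a l) h \<le> 2 * average (cube a l) (\<lambda>x. \<bar>h x\<bar>)"
      using hint l by (intro osc_le_average_abs) (auto simp: measure_cube)
    also have "\<dots> \<le> 4 * (p * e)" using hav[OF True l(2)] by (simp add: mult_ac)
    also have "\<dots> \<le> 10 * (p * e)" using p \<open>0 < e\<close> by (intro mult_right_mono) auto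
    finally show ?thesis by simp
  next
    case False
    let ?Q = "cube a l"
    show ?thesis
    proof (cases "\<exists>x0\<in>?Q. \<phi> x0 \<noteq> 0")
      case none: False
      then have "osc ?Q h \<le> 2 * 0"
        using hint l by (intro osc_le_const[where c = 0]) (auto simp: measure_cube h0)
      also have "\<dots> \<le> 10 * p * e" using p \<open>0 < e\<close> by simp
      finally show ?thesis .
    next
      case True
      then obtain x0 where x0: "x0 \<in> ?Q" "\<phi> x0 \<noteq> 0" by blast
      have sub: "?Q \<subseteq> cube a r" using False by (intro cube_mono) simp
      let ?c = "average (cube a (2 * r)) f"
      have "x0 \<in> cube a r" using x0 sub by blast
      then have QT: "?Q \<subseteq> T" and uc: "\<And>x. x \<in> ?Q \<Longrightarrow> \<bar>u x - ?c\<bar> \<le> p * e"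
        using loc[of r x0 a] x0 r sub by auto
      have Q: "?Q \<in> lmeasurable" "0 < measure lebesgue ?Q" using l by (auto simp: measure_cube)
      have ui: "u absolutely_integrable_on ?Q"
        by (intro continuous_on_cube_integrable continuous_on_subset[OF ucont QT])
      have fi: "f absolutely_integrable_on ?Q" using int l by auto
      have "osc ?Q (\<lambda>x. f x - u x) \<le> osc ?Q f + osc ?Q u" using Q fi ui by (intro osc_diff)
      also have "osc ?Q u \<le> 2 * (p * e)" using Q ui uc by (intro osc_le_const)
      also have "osc ?Q f \<le> e" using l False r by (intro local.osc) auto
      finally have fu: "osc ?Q (\<lambda>x. f x - u x) \<le> e + 2 * (p * e)" by simp
      have "h = (\<lambda>x. \<phi> x * (f x - u x))" by (simp add: h_def g_def fun_eq_iff algebra_simps)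
      moreover have "osc ?Q (\<lambda>x. \<phi> x * (f x - u x))
          \<le> 2 * (2 * M * osc ?Q \<phi> + 1 * osc ?Q (\<lambda>x. f x - u x))"
      proof (rule osc_mult[OF Q])
        show "\<bar>f x - u x\<bar> \<le> 2 * M" if "x \<in> ?Q" for x
          using M[of x] uM[of x] QT that by fastforce
        show "(\<lambda>x. f x - u x) absolutely_integrable_on ?Q"
          using fi ui by (intro set_integral_diff)
        then show "(\<lambda>x. \<phi> x * (f x - u x)) absolutely_integrable_on ?Q"
          by (intro bounded_mult_cube_integrable \<phi>cont)
      qed (use \<phi>int \<phi>0 \<phi>1 in auto)
      moreover have "2 * M * osc ?Q \<phi> \<le> 2 * M * (e / M)"
        using \<phi>osc l \<open>0 < M\<close> by (intro mult_left_mono) auto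
      ultimately have "osc ?Q h \<le> 6 * e + 4 * (p * e)" using fu \<open>0 < M\<close> by simp
      also have "6 * e \<le> 6 * (p * e)" using p \<open>0 < e\<close> by simp
      finally show ?thesis by (simp add: mult_ac)
    qed
  qed

  \<comment> \<open>The cut-off error: both its oscillation on small cubes and its average on large
    ones are paid for by the tolerance \<open>e / M\<close>. Its bounds \<open>4 * e\<close> and
    \<open>e\<close> complete the constants 14 and 3.\<close>
  define k where "k x = (1 - \<phi> x) * f x" for x
  have kint: "k absolutely_integrable_on cube a l" if "0 < l" "cube a l \<subseteq> \<Omega>" for a l
    unfolding k_def using that int
    by (intro bounded_mult_cube_integrable continuous_intros \<phi>cont)
  have split: "(\<lambda>x. f x - g x) = (\<lambda>x. k x + h x)"
    by (simp add: k_def h_def fun_eq_iff algebra_simps)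
  have pe: "e \<le> p * e" using p \<open>0 < e\<close> by simp
  show ?thesis
  proof (rule that[OF g0])
    fix a :: "real ^ 'n" and l
    assume l: "0 < l" "l < s" "cube a l \<subseteq> \<Omega>"
    let ?Q = "cube a l"
    have Q: "?Q \<in> lmeasurable" "0 < measure lebesgue ?Q" using l by (auto simp: measure_cube)
    have "osc ?Q k \<le> 2 * (M * osc ?Q (\<lambda>x. 1 - \<phi> x) + 1 * osc ?Q f)"
      unfolding k_def
    proof (rule osc_mult[OF Q])
      show "(\<lambda>x. (1 - \<phi> x) * f x) absolutely_integrable_on ?Q"
        using kint[of l a] l unfolding k_def by simp
    qed (use \<phi>0 \<phi>1 M int l \<phi>int in \<open>auto intro!: absolutely_integrable_on_const\<close>)
    also have "osc ?Q (\<lambda>x. 1 - \<phi> x) = osc ?Q \<phi>" using Q \<phi>int by (rule osc_const_diff)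
    also have "M * osc ?Q \<phi> \<le> M * (e / M)" using \<phi>osc l \<open>0 < M\<close> by (intro mult_left_mono) auto
    also have "M * (e / M) = e" using \<open>0 < M\<close> by simp
    also have "osc ?Q f \<le> e" using l by (intro local.osc)
    finally have "osc ?Q k \<le> 4 * e" by simp
    moreover have "osc ?Q (\<lambda>x. k x + h x) \<le> osc ?Q k + osc ?Q h"
      using Q kint hint l by (intro osc_add) auto
    ultimately show "osc ?Q (\<lambda>x. f x - g x) \<le> 14 * 4 ^ CARD('n) * e"
      unfolding split p_def[symmetric] using hosc[OF l(1,3)] pe by linarith
  next
    fix a :: "real ^ 'n" and l
    assume l: "s \<le> l" "cube a l \<subseteq> \<Omega>"
    let ?Q = "cube a l"
    have "0 < l" using l \<open>0 < s\<close> by linarith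
    have "average ?Q (\<lambda>x. \<bar>k x\<bar>) \<le> average ?Q (\<lambda>x. M * (1 - \<phi> x))"
    proof (rule average_mono)
      show "(\<lambda>x. \<bar>k x\<bar>) absolutely_integrable_on ?Q"
        using kint l \<open>0 < l\<close> by (intro set_integrable_abs)
      show "(\<lambda>x. M * (1 - \<phi> x)) absolutely_integrable_on ?Q"
        using \<phi>int
        by (intro set_integrable_mult_right set_integral_diff absolutely_integrable_on_const) auto
      show "\<bar>k x\<bar> \<le> M * (1 - \<phi> x)" for x
        using M[of x] \<phi>1[of x] unfolding k_def abs_mult
        by (subst mult.commute) (simp add: mult_right_mono)
    qed
    also have "\<dots> = M * average ?Q (\<lambda>x. 1 - \<phi> x)" by (rule average_cmult)
    also have "\<dots> \<le> M * (e / M)" using \<phi>av l \<open>0 < M\<close> by (intro mult_left_mono) auto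
    also have "\<dots> = e" using \<open>0 < M\<close> by simp
    finally have "average ?Q (\<lambda>x. \<bar>k x\<bar>) \<le> e" .
    moreover have "average ?Q (\<lambda>x. \<bar>k x + h x\<bar>) \<le> average ?Q (\<lambda>x. \<bar>k x\<bar> + \<bar>h x\<bar>)"
      using kint hint l \<open>0 < l\<close> by (intro average_mono set_integrable_abs set_integral_add) auto
    moreover have "average ?Q (\<lambda>x. \<bar>k x\<bar> + \<bar>h x\<bar>) = average ?Q (\<lambda>x. \<bar>k x\<bar>) + average ?Q (\<lambda>x. \<bar>h x\<bar>)"
      using kint hint l \<open>0 < l\<close> by (intro average_add set_integrable_abs) auto
    moreover have "average ?Q (\<lambda>x. \<bar>h x\<bar>) \<le> 2 * p * e" using r l by (intro hav) auto
    ultimately show "average ?Q (\<lambda>x. \<bar>f x - g x\<bar>) \<le> 3 * 4 ^ CARD('n) * e"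
      using pe unfolding fun_cong[OF split] p_def[symmetric] by linarith
  qed
qed

subsection \<open>The bmo norm\<close>

lemma osc_modulus_eq_SUP_osc:
  "osc_modulus \<Omega> f t = (SUP (a, l) \<in> {(a, l). 0 < l \<and> l < t \<and> cube a l \<subseteq> \<Omega>}. ennreal (osc (cube a l) f))"
  by (simp add: osc_modulus_def osc_def)

lemma osc_le_osc_modulus:
  "0 < l \<Longrightarrow> l < t \<Longrightarrow> cube a l \<subseteq> \<Omega> \<Longrightarrow> ennreal (osc (cube a l) f) \<le> osc_modulus \<Omega> f t"
  unfolding osc_modulus_eq_SUP_osc by (rule SUP_upper2[of "(a, l)"]) auto

lemma osc_modulus_le:
  assumes "\<And>a l. 0 < l \<Longrightarrow> l < t \<Longrightarrow> cube a l \<subseteq> \<Omega> \<Longrightarrow> osc (cube a l) f \<le> e"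
  shows "osc_modulus \<Omega> f t \<le> ennreal e"
  unfolding osc_modulus_eq_SUP_osc using assms by (auto intro!: SUP_least ennreal_leI)

lemma osc_modulus_mono: "s \<le> t \<Longrightarrow> osc_modulus \<Omega> f s \<le> osc_modulus \<Omega> f t"
  unfolding osc_modulus_def by (intro SUP_subset_mono) auto

lemma average_le_bmo_norm:
  assumes "0 < l" "lam \<le> l" "cube a l \<subseteq> \<Omega>"
  shows "ennreal (average (cube a l) (\<lambda>x. \<bar>f x\<bar>)) \<le> bmo_norm lam \<Omega> f"
proof -
  have "ennreal (average (cube a l) (\<lambda>x. \<bar>f x\<bar>))
      \<le> (SUP (a, l) \<in> {(a, l). 0 < l \<and> lam \<le> l \<and> cube a l \<subseteq> \<Omega>}.
          ennreal (average (cube a l) (\<lambda>x. \<bar>f x\<bar>)))"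
    using assms by (intro SUP_upper2[of "(a, l)"]) auto
  also have "\<dots> \<le> bmo_norm lam \<Omega> f" unfolding bmo_norm_def by (rule add_increasing) auto
  finally show ?thesis .
qed

lemma osc_modulus_le_bmo_norm: "osc_modulus \<Omega> f lam \<le> bmo_norm lam \<Omega> f"
  unfolding bmo_norm_def by (rule add_increasing2) auto

lemma bmo_norm_le:
  assumes "0 \<le> A" "0 \<le> B"
    and "\<And>a l. 0 < l \<Longrightarrow> l < lam \<Longrightarrow> cube a l \<subseteq> \<Omega> \<Longrightarrow> osc (cube a l) f \<le> A"
    and "\<And>a l. 0 < l \<Longrightarrow> lam \<le> l \<Longrightarrow> cube a l \<subseteq> \<Omega> \<Longrightarrow> average (cube a l) (\<lambda>x. \<bar>f x\<bar>) \<le> B"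
  shows "bmo_norm lam \<Omega> f \<le> ennreal (A + B)"
  unfolding bmo_norm_def ennreal_plus[OF assms(1,2)] using assms(3,4)
  by (intro add_mono osc_modulus_le SUP_least) (auto intro: ennreal_leI)

section \<open>The inclusions between the four sets of the theorem\<close>

lemma Lip_b_continuous_on: "f \<in> Lip_b \<Omega> \<Longrightarrow> S \<subseteq> \<Omega> \<Longrightarrow> continuous_on S f"
  unfolding Lip_b_def using lipschitz_on_continuous_on continuous_on_subset by blast

text \<open>A bound on \<open>f\<close> controls both parts of the norm, for any \<open>lam\<close>.
  The closure admits only approximants in \<open>bmo\<close>, and this is how the constructed ones
  qualify.\<close>

lemma Lip_b_subset_bmo:
  fixes \<Omega> :: "(real ^ 'n) set"
  shows "Lip_b \<Omega> \<subseteq> bmo lam \<Omega>"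
proof
  fix f :: "real ^ 'n \<Rightarrow> real" assume f: "f \<in> Lip_b \<Omega>"
  have int: "f absolutely_integrable_on cube a l" if "cube a l \<subseteq> \<Omega>" for a l
    using Lip_b_continuous_on[OF f that] by (rule continuous_on_cube_integrable)
  obtain M where "\<forall>x\<in>\<Omega>. \<bar>f x\<bar> \<le> M" using f unfolding Lip_b_def bounded_iff by auto
  then have M: "0 \<le> \<bar>M\<bar>" "\<And>x. x \<in> \<Omega> \<Longrightarrow> \<bar>f x\<bar> \<le> \<bar>M\<bar>" by force+
  have "bmo_norm lam \<Omega> f \<le> ennreal (2 * \<bar>M\<bar> + \<bar>M\<bar>)"
  proof (rule bmo_norm_le)
    fix a :: "real ^ 'n" and l :: real
    assume l: "0 < l" "cube a l \<subseteq> \<Omega>"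
    then show "osc (cube a l) f \<le> 2 * \<bar>M\<bar>"
      using int M by (intro osc_le_const[where c = 0]) (auto simp: measure_cube)
    show "average (cube a l) (\<lambda>x. \<bar>f x\<bar>) \<le> \<bar>M\<bar>"
      using l int M by (intro average_le_const set_integrable_abs) (auto simp: measure_cube)
  qed auto
  also have "\<dots> < \<infinity>" by simp
  finally show "f \<in> bmo lam \<Omega>" using int unfolding bmo_def by auto
qed

lemma bmo_closure_mono: "A \<subseteq> B \<Longrightarrow> bmo_closure lam \<Omega> A \<subseteq> bmo_closure lam \<Omega> B"
  unfolding bmo_closure_def by blast

lemma Lip_b_subset_UC_Linfty:
  fixes \<Omega> :: "(real ^ 'n) set"
  assumes "open \<Omega>"
  shows "Lip_b \<Omega> \<subseteq> UC \<Omega> \<inter> Linfty \<Omega>"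
proof
  fix f :: "real ^ 'n \<Rightarrow> real" assume f: "f \<in> Lip_b \<Omega>"
  have "uniformly_continuous_on \<Omega> f"
    using f unfolding Lip_b_def by (auto intro: lipschitz_on_uniformly_continuous)
  moreover have "set_borel_measurable lebesgue \<Omega> f"
  proof -
    have "\<Omega> \<in> sets lebesgue" using assms by auto
    then have "f \<in> borel_measurable (lebesgue_on \<Omega>)"
      using Lip_b_continuous_on[OF f order_refl] by (intro continuous_imp_measurable_on_sets_lebesgue)
    then show ?thesis
      using \<open>\<Omega> \<in> sets lebesgue\<close> unfolding set_borel_measurable_def
      by (subst (asm) borel_measurable_restrict_space_iff) auto
  qed
  moreover obtain M where "\<forall>x\<in>\<Omega>. \<bar>f x\<bar> \<le> M" using f unfolding Lip_b_def bounded_iff by auto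
  ultimately show "f \<in> UC \<Omega> \<inter> Linfty \<Omega>" unfolding UC_def Linfty_def by auto
qed

lemma bmo_closure_UC_vanishing_oscillation:
  fixes f :: "real ^ 'n \<Rightarrow> real"
  assumes "0 < lam" and f: "f \<in> bmo_closure lam \<Omega> (UC \<Omega>)"
  shows "(osc_modulus \<Omega> f \<longlongrightarrow> 0) (at_right 0)"
proof (rule order_tendstoI)
  fix c :: ennreal assume "0 < c"
  \<comment> \<open>The threshold \<open>c\<close> may be infinite, so a real number is picked below
    it; the approximation error takes one \<open>e\<close> and the oscillation of \<open>g\<close>
    two.\<close>
  obtain e where e: "0 < e" "ennreal (3 * e) < c"
  proof -
    obtain y where y: "0 < y" "y < c" using dense[OF \<open>0 < c\<close>] by blast
    then obtain d where "0 < d" "ennreal d < c" by (cases y) auto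
    then show ?thesis using that[of "d / 3"] by simp
  qed
  obtain g where g: "g \<in> UC \<Omega>" "g \<in> bmo lam \<Omega>" "bmo_norm lam \<Omega> (\<lambda>x. f x - g x) < ennreal e"
    using f e unfolding bmo_closure_def by blast
  obtain d where d: "0 < d" "\<And>x y. x \<in> \<Omega> \<Longrightarrow> y \<in> \<Omega> \<Longrightarrow> dist x y < d \<Longrightarrow> \<bar>g x - g y\<bar> < e"
    using g(1) e unfolding UC_def uniformly_continuous_on_def
    by (auto simp: dist_real_def dist_commute abs_minus_commute)
  have fb: "f \<in> bmo lam \<Omega>" using f unfolding bmo_closure_def by blast
  \<comment> \<open>Below \<open>lam\<close> the norm controls the oscillation of
    \<open>f - g\<close>; below \<open>d / real CARD('n)\<close> all points of a cube lie within
    distance \<open>d\<close> of its corner.\<close>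
  define t where "t = min lam (d / real CARD('n))"
  have t: "0 < t" using d assms unfolding t_def by simp
  have "osc_modulus \<Omega> f t \<le> ennreal (3 * e)"
  proof (rule osc_modulus_le)
    fix a :: "real ^ 'n" and l
    assume l: "0 < l" "l < t" "cube a l \<subseteq> \<Omega>"
    let ?Q = "cube a l"
    have int: "f absolutely_integrable_on ?Q" "g absolutely_integrable_on ?Q"
      using l fb g(2) unfolding bmo_def by auto
    have "ennreal (osc ?Q (\<lambda>x. f x - g x)) \<le> osc_modulus \<Omega> (\<lambda>x. f x - g x) lam"
      using l unfolding t_def by (intro osc_le_osc_modulus) auto
    also have "\<dots> < ennreal e" using osc_modulus_le_bmo_norm g(3) by (rule le_less_trans)
    finally have 1: "osc ?Q (\<lambda>x. f x - g x) \<le> e"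
      using e(1) by (simp add: ennreal_less_iff osc_nonneg)
    have 2: "osc ?Q g \<le> 2 * e"
    proof (rule osc_le_const[where c = "g a"])
      fix x assume x: "x \<in> ?Q"
      have a: "a \<in> ?Q" using l by (simp add: mem_cube)
      have "dist x a \<le> real CARD('n) * l" using x a by (rule dist_cube_le)
      also have "\<dots> < real CARD('n) * (d / real CARD('n))"
        using l unfolding t_def by (intro mult_strict_left_mono) auto
      finally have "dist x a < d" by simp
      then show "\<bar>g x - g a\<bar> \<le> e" using d(2)[of x a] x a l by fastforce
    qed (use l int in \<open>auto simp: measure_cube\<close>)
    have "osc ?Q (\<lambda>x. (f x - g x) + g x) \<le> osc ?Q (\<lambda>x. f x - g x) + osc ?Q g"
      using int by (intro osc_add set_integral_diff) auto
    then show "osc ?Q f \<le> 3 * e" using 1 2 by simp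
  qed
  then have "osc_modulus \<Omega> f t < c" using e(2) by (rule le_less_trans)
  then have "osc_modulus \<Omega> f s < c" if "s < t" for s
    using osc_modulus_mono[of s t \<Omega> f] that by (meson le_less_trans less_imp_le)
  then show "\<forall>\<^sub>F s in at_right 0. osc_modulus \<Omega> f s < c"
    using t unfolding eventually_at_right_field by blast
qed simp

text \<open>If \<open>M\<close> bounds the averages of \<open>f\<close>, then \<open>\<bar>f - max (- M) (min M f)\<bar> \<le> \<bar>f - average Q f\<bar>\<close>,
  so cubes on which \<open>f\<close> oscillates little see a small truncation error.\<close>

lemma vanishing_oscillation_in_closure:
  fixes f :: "real ^ 'n \<Rightarrow> real"
  assumes "open \<Omega>" "0 < lam"
    and bmo_eq: "\<And>lam'. 0 < lam' \<Longrightarrow> lam' \<le> lam \<Longrightarrow> bmo lam' \<Omega> = bmo lam \<Omega>"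
    and f: "f \<in> bmo lam \<Omega>" and lim: "(osc_modulus \<Omega> f \<longlongrightarrow> 0) (at_right 0)"
  shows "f \<in> bmo_closure lam \<Omega> (Lip_b0 \<Omega>)"
proof -
  have int: "f absolutely_integrable_on cube a l" if "0 < l" "cube a l \<subseteq> \<Omega>" for a l
    using f that unfolding bmo_def by blast
  have "\<exists>g\<in>Lip_b0 \<Omega> \<inter> bmo lam \<Omega>. bmo_norm lam \<Omega> (\<lambda>x. f x - g x) < ennreal \<epsilon>" if "0 < \<epsilon>" for \<epsilon>
  proof -
    define p :: real where "p = 4 ^ CARD('n)"
    have p: "1 \<le> p" unfolding p_def by simp
    \<comment> \<open>The final error is \<open>38 * p * e\<close>; the extra factor 2 makes the
      inequality strict.\<close>
    define e where "e = \<epsilon> / (76 * p)"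
    have e: "0 < e" using that p unfolding e_def by simp
    have pe: "e \<le> p * e" using p e by simp
    have "\<forall>\<^sub>F t in at_right 0. osc_modulus \<Omega> f t < ennreal e"
      using lim e by (intro order_tendstoD(2)) auto
    then obtain b where b: "0 < b" "\<And>t. 0 < t \<Longrightarrow> t < b \<Longrightarrow> osc_modulus \<Omega> f t < ennreal e"
      unfolding eventually_at_right_field by blast
    \<comment> \<open>The oscillation must be small up to side \<open>2 * s\<close>, because
      subdividing a large cube produces sides in \<open>[s, 2 * s)\<close>.\<close>
    define s where "s = min (lam / 2) (b / 4)"
    have s: "0 < s" "s \<le> lam" "2 * s < b" using b \<open>0 < lam\<close> unfolding s_def by auto
    have fosc: "osc (cube a l) f \<le> e" if "0 < l" "l < 2 * s" "cube a l \<subseteq> \<Omega>" for a l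
    proof -
      have "ennreal (osc (cube a l) f) < ennreal e"
        using s by (intro le_less_trans[OF osc_le_osc_modulus[OF that] b(2)]) auto
      then show ?thesis using e by (simp add: ennreal_less_iff osc_nonneg)
    qed
    \<comment> \<open>The hypothesis enters here: it makes the norm of this \<open>f\<close> at the
      smaller scale finite, and so bounds its averages over all cubes of side at least
      \<open>s\<close>.\<close>
    have "f \<in> bmo s \<Omega>" using bmo_eq s f by blast
    then obtain K where K: "0 \<le> K" "bmo_norm s \<Omega> f = ennreal K"
      unfolding bmo_def by (cases "bmo_norm s \<Omega> f") auto
    define M where "M = K + 1"
    have M: "0 < M" "K \<le> M" using K unfolding M_def by auto
    have fav: "\<bar>average (cube a l) f\<bar> \<le> M" if "s \<le> l" "cube a l \<subseteq> \<Omega>" for a l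
    proof -
      have "0 < l" using that s by linarith
      then have "ennreal (average (cube a l) (\<lambda>x. \<bar>f x\<bar>)) \<le> ennreal K"
        using average_le_bmo_norm[OF _ that, of f] K(2) by simp
      then have "average (cube a l) (\<lambda>x. \<bar>f x\<bar>) \<le> K" using K(1) by simp
      then show ?thesis using abs_average_le[OF int[OF \<open>0 < l\<close> that(2)]] M by linarith
    qed
    define trunc where "trunc v = max (- M) (min M v)" for v
    have tlip: "\<bar>trunc v - trunc w\<bar> \<le> \<bar>v - w\<bar>" for v w
      unfolding trunc_def by (simp add: max_def min_def)
    have tM: "\<bar>trunc v\<bar> \<le> M" for v using M unfolding trunc_def by (simp add: max_def min_def abs_le_iff)
    \<comment> \<open>\<open>trunc v\<close> is the point of \<open>[- M, M]\<close> nearest to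
      \<open>v\<close>; the competitor \<open>c\<close> will be a mean of \<open>f\<close>.\<close>
    have tproj: "\<bar>v - trunc v\<bar> \<le> \<bar>v - c\<bar>" if "\<bar>c\<bar> \<le> M" for v c
      using that unfolding trunc_def by (simp add: max_def min_def abs_if split: if_splits)
    have tint: "(\<lambda>x. trunc (f x)) absolutely_integrable_on cube a l"
      if "0 < l" "cube a l \<subseteq> \<Omega>" for a l
      unfolding trunc_def using int[OF that]
      by (intro absolutely_integrable_max_1 absolutely_integrable_min_1
          absolutely_integrable_on_const) auto
    have tosc: "osc (cube a l) (\<lambda>x. trunc (f x)) \<le> 2 * e" if "0 < l" "l < s" "cube a l \<subseteq> \<Omega>" for a l
    proof -
      have "osc (cube a l) (\<lambda>x. trunc (f x)) \<le> 2 * osc (cube a l) f"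
        using that int tint tlip by (intro osc_lipschitz_comp) (auto simp: measure_cube)
      then show ?thesis using fosc[of l a] that by simp
    qed
    have "0 < 2 * e" using e by simp
    then obtain g where g: "g \<in> Lip_b0 \<Omega>"
      and gosc: "\<And>a l. 0 < l \<Longrightarrow> l < s \<Longrightarrow> cube a l \<subseteq> \<Omega> \<Longrightarrow>
         osc (cube a l) (\<lambda>x. trunc (f x) - g x) \<le> 14 * 4 ^ CARD('n) * (2 * e)"
      and gav: "\<And>a l. s \<le> l \<Longrightarrow> cube a l \<subseteq> \<Omega> \<Longrightarrow>
         average (cube a l) (\<lambda>x. \<bar>trunc (f x) - g x\<bar>) \<le> 3 * 4 ^ CARD('n) * (2 * e)"
      using approx_bounded_by_Lip_b0[of \<Omega> s "2 * e" M "\<lambda>x. trunc (f x)"]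
        \<open>open \<Omega>\<close> s(1) M(1) tint tM tosc by blast
    have gbmo: "g \<in> bmo lam \<Omega>" using g Lip_b_subset_bmo unfolding Lip_b0_def by blast
    then have gint: "g absolutely_integrable_on cube a l" if "0 < l" "cube a l \<subseteq> \<Omega>" for a l
      using that unfolding bmo_def by blast
    define h where "h x = f x - trunc (f x)" for x
    have hint: "h absolutely_integrable_on cube a l" if "0 < l" "cube a l \<subseteq> \<Omega>" for a l
      unfolding h_def using int tint that by (intro set_integral_diff) auto
    have kint: "(\<lambda>x. trunc (f x) - g x) absolutely_integrable_on cube a l"
      if "0 < l" "cube a l \<subseteq> \<Omega>" for a l
      using gint tint that by (intro set_integral_diff) auto
    have hav: "average (cube a l) (\<lambda>x. \<bar>h x\<bar>) \<le> e" if l: "s \<le> l" "cube a l \<subseteq> \<Omega>" for a l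
    proof (rule average_le_of_small_cubes[OF s(1) l(1)])
      show "(\<lambda>x. \<bar>h x\<bar>) absolutely_integrable_on cube a l"
        using hint l s by (intro set_integrable_abs) auto
      fix b k assume k: "s \<le> k" "k < 2 * s" "cube b k \<subseteq> cube a l"
      have "0 < k" "cube b k \<subseteq> \<Omega>" using k l s by auto
      then have "\<bar>h x\<bar> \<le> \<bar>f x - average (cube b k) f\<bar>" for x
        unfolding h_def using k(1) by (intro tproj fav)
      then have "average (cube b k) (\<lambda>x. \<bar>h x\<bar>) \<le> osc (cube b k) f"
        unfolding osc_def using hint int \<open>0 < k\<close> \<open>cube b k \<subseteq> \<Omega>\<close>
        by (intro average_mono set_integrable_abs absolutely_integrable_on_abs_minus_const) auto
      then show "average (cube b k) (\<lambda>x. \<bar>h x\<bar>) \<le> e"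
        using fosc[of k b] \<open>0 < k\<close> \<open>cube b k \<subseteq> \<Omega>\<close> k by linarith
    qed simp
    have split: "(\<lambda>x. f x - g x) = (\<lambda>x. h x + (trunc (f x) - g x))"
      by (simp add: h_def)
    have av: "average (cube a l) (\<lambda>x. \<bar>f x - g x\<bar>) \<le> 7 * (p * e)" if l: "s \<le> l" "cube a l \<subseteq> \<Omega>" for a l
    proof -
      have "0 < l" using l s by linarith
      note i = set_integrable_abs[OF hint[OF \<open>0 < l\<close> l(2)]] set_integrable_abs[OF kint[OF \<open>0 < l\<close> l(2)]]
      have "average (cube a l) (\<lambda>x. \<bar>f x - g x\<bar>)
          \<le> average (cube a l) (\<lambda>x. \<bar>h x\<bar> + \<bar>trunc (f x) - g x\<bar>)"
      proof (rule average_mono[OF set_integrable_abs set_integral_add(1)[OF i]])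
        show "(\<lambda>x. f x - g x) absolutely_integrable_on cube a l"
          using int gint \<open>0 < l\<close> l by (intro set_integral_diff) auto
      qed (simp add: h_def)
      also have "\<dots> \<le> e + 3 * p * (2 * e)"
        unfolding average_add[OF i] p_def using hav gav l by (intro add_mono) auto
      finally show ?thesis using pe by simp
    qed
    have "bmo_norm lam \<Omega> (\<lambda>x. f x - g x) \<le> ennreal (31 * (p * e) + 7 * (p * e))"
    proof (rule bmo_norm_le)
      fix a :: "real ^ 'n" and l :: real
      assume l: "0 < l" "cube a l \<subseteq> \<Omega>"
      show "osc (cube a l) (\<lambda>x. f x - g x) \<le> 31 * (p * e)"
      proof (cases "l < s")
        case True
        have "osc (cube a l) h \<le> osc (cube a l) f + osc (cube a l) (\<lambda>x. trunc (f x))"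
          unfolding h_def using l int tint by (intro osc_diff) auto
        also have "\<dots> \<le> e + 2 * e" using fosc tosc l True by (intro add_mono) auto
        finally have "osc (cube a l) h \<le> 3 * e" by simp
        moreover have "osc (cube a l) (\<lambda>x. h x + (trunc (f x) - g x))
            \<le> osc (cube a l) h + osc (cube a l) (\<lambda>x. trunc (f x) - g x)"
          using l hint kint by (intro osc_add) auto
        moreover have "osc (cube a l) (\<lambda>x. trunc (f x) - g x) \<le> 28 * (p * e)"
          using gosc[OF l(1) True l(2)] by (simp add: p_def)
        ultimately show ?thesis unfolding split using pe by linarith
      next
        \<comment> \<open>The norm asks for the oscillation up to side \<open>lam\<close>, but that
          of \<open>f\<close> is small only below \<open>2 * s\<close>. From side \<open>s\<close>
          on it is the average of the error that is small, and twice this average bounds the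
          oscillation.\<close>
        case False
        have "osc (cube a l) (\<lambda>x. f x - g x) \<le> 2 * average (cube a l) (\<lambda>x. \<bar>f x - g x\<bar>)"
          using l int gint by (intro osc_le_average_abs set_integral_diff) (auto simp: measure_cube)
        also have "\<dots> \<le> 2 * (7 * (p * e))" using av False l by (intro mult_left_mono) auto
        also have "\<dots> \<le> 31 * (p * e)" using p e by simp
        finally show ?thesis .
      qed
      show "average (cube a l) (\<lambda>x. \<bar>f x - g x\<bar>) \<le> 7 * (p * e)" if "lam \<le> l"
        using av s that l by simp
    qed (use p e in auto)
    also have "31 * (p * e) + 7 * (p * e) = \<epsilon> / 2" unfolding e_def using p by simp
    also have "ennreal (\<epsilon> / 2) < ennreal \<epsilon>" using that by (simp add: ennreal_less_iff)
    finally show ?thesis using g gbmo by blast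
  qed
  then show ?thesis using f unfolding bmo_closure_def by blast
qed

theorem theorem1:
  fixes \<Omega> :: "(real ^ 'n) set" and lam :: real
  assumes "open \<Omega>" and "connected \<Omega>"
    and "lam > 0"
    and "\<And>lam'. 0 < lam' \<Longrightarrow> lam' \<le> lam \<Longrightarrow> bmo lam' \<Omega> = bmo lam \<Omega>"
  shows "{f \<in> bmo lam \<Omega>. (osc_modulus \<Omega> f \<longlongrightarrow> 0) (at_right 0)}
           = bmo_closure lam \<Omega> (UC \<Omega> \<inter> Linfty \<Omega>)
       \<and> bmo_closure lam \<Omega> (UC \<Omega> \<inter> Linfty \<Omega>) = bmo_closure lam \<Omega> (Lip_b \<Omega>)
       \<and> bmo_closure lam \<Omega> (Lip_b \<Omega>) = bmo_closure lam \<Omega> (Lip_b0 \<Omega>)"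
proof -
  let ?V = "{f \<in> bmo lam \<Omega>. (osc_modulus \<Omega> f \<longlongrightarrow> 0) (at_right 0)}"
  have "?V \<subseteq> bmo_closure lam \<Omega> (Lip_b0 \<Omega>)"
    using vanishing_oscillation_in_closure[OF assms(1,3,4)] by blast
  moreover have "bmo_closure lam \<Omega> (Lip_b0 \<Omega>) \<subseteq> bmo_closure lam \<Omega> (Lip_b \<Omega>)"
    by (intro bmo_closure_mono) (auto simp: Lip_b0_def)
  moreover have "bmo_closure lam \<Omega> (Lip_b \<Omega>) \<subseteq> bmo_closure lam \<Omega> (UC \<Omega> \<inter> Linfty \<Omega>)"
    using Lip_b_subset_UC_Linfty[OF assms(1)] by (rule bmo_closure_mono)
  moreover have "bmo_closure lam \<Omega> (UC \<Omega> \<inter> Linfty \<Omega>) \<subseteq> ?V"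
  proof
    fix f assume "f \<in> bmo_closure lam \<Omega> (UC \<Omega> \<inter> Linfty \<Omega>)"
    then have "f \<in> bmo_closure lam \<Omega> (UC \<Omega>)"
      using bmo_closure_mono[OF Int_lower1] by blast
    then show "f \<in> ?V"
      using bmo_closure_UC_vanishing_oscillation[OF assms(3)] unfolding bmo_closure_def by blast
  qed
  ultimately show ?thesis by blast
qed

end
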